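(* Let $\alpha\in(0,\tfrac32)$ and let $\rho\colon[1,\infty)\to(0,\infty)$ be regularly varying with index $-\alpha$. Let $c_\#>0$ and let $N_\#\ge 1$ be an integer. Then there is a constant $C$, depending only on $c_\#$, $N_\#$ and $\rho$, such that the following holds. Let $(p_n)_{n\ge1}$ be any sequence of non-negative reals with $\sum_{n\ge1}p_n=1$, with $\gcd\{1\le k\le N_\# : p_k\ge c_\#\}=1$, and with $\sum_{k>n}p_k\le\rho(n)$ for all $n\ge1$. Let $P$ be the transition operator of the Markov chain on $\{0,1,2,\ldots\}$ associated with $(p_n)$ as described in the context. Then $$\|P^{n+\ell}\delta_0-P^n\delta_0\|_{\mathrm{TV}}\le C\,\ell^{2/3}\rho(n)^{1/3}$$ for all integers $n\ge1$ and $\ell\ge1$ which satisfy, in addition: (i) if $\alpha=1$: $\ell\le\rho(n)\,n^{3/2}M(n)^{-3/2}$, where $M(n)=1+\int_1^n\rho(t)\,dt$; (ii) if $\alpha\in(1,\tfrac32)$: $\ell\le\rho(n)\,n^{3/2}$. (If $\alpha<1$ there is no additional restriction on $n,\ell$.)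
   Context: Model chain: given $p_n\ge0$ with $\sum_{n\ge1}p_n=1$, put $z_n=\sum_{k>n}p_k$ for $n\ge0$ and $q_n=p_{n+1}/z_n$ if $z_n>0$ (with $q_n\in[0,1]$ arbitrary if $z_n=0$). The associated Markov chain $X$ on $\{0,1,2,\ldots\}$ has transition probabilities $\mathbb P(X_1=0\mid X_0=n)=q_n$ and $\mathbb P(X_1=n+1\mid X_0=n)=1-q_n$. Thus $p_n$ is the probability that the first return time to $0$, starting from $0$, equals $n$. Its transition operator $P$ acts on probability measures: if $X_n\sim\mu$ then $X_{n+1}\sim P\mu$. $\delta_0$ is the unit mass at state $0$. $\|\cdot\|_{\mathrm{TV}}$ is the total variation norm, normalized so that $\|\mu-\nu\|_{\mathrm{TV}}=2\sup_A|\mu(A)-\nu(A)|$ for probability measures $\mu,\nu$. A (measurable) function $\rho\colon[a,\infty)\to(0,\infty)$ is regularly varying with index $\beta\in\mathbb R$ if $\lim_{x\to\infty}\rho(\lambda x)/\rho(x)=\lambda^\beta$ for every $\lambda>0$. *)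

theory Defs
  imports "HOL-Probability.Probability"
begin

definition regularly_varying :: "real \<Rightarrow> real \<Rightarrow> (real \<Rightarrow> real) \<Rightarrow> bool" where
  "regularly_varying a \<beta> \<rho> \<longleftrightarrow>
     \<rho> \<in> borel_measurable (lebesgue_on {a..}) \<and>
     (\<forall>x\<ge>a. \<rho> x > 0) \<and>
     (\<forall>c>0. ((\<lambda>x. \<rho> (c * x) / \<rho> x) \<longlongrightarrow> c powr \<beta>) at_top)"

text \<open>
  A return time law is a sequence \<open>p\<close> indexed by \<open>n \<ge> 1\<close>; the value \<open>p 0\<close> is never used.
\<close>

definition return_law :: "(nat \<Rightarrow> real) \<Rightarrow> bool" where
  "return_law p \<longleftrightarrow> (\<forall>n\<ge>1. p n \<ge> 0) \<and> (p has_sum 1) {1..}"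

definition tail :: "(nat \<Rightarrow> real) \<Rightarrow> nat \<Rightarrow> real" where
  "tail p n = (\<Sum>\<^sub>\<infinity>k\<in>{n<..}. p k)"

text \<open>
  The reset probabilities \<open>q n\<close> are determined by \<open>p\<close> only where the tail is positive and are
  arbitrary in \<open>[0,1]\<close> elsewhere, hence a relation instead of a function.
\<close>

definition reset_probs :: "(nat \<Rightarrow> real) \<Rightarrow> (nat \<Rightarrow> real) \<Rightarrow> bool" where
  "reset_probs p q \<longleftrightarrow>
     (\<forall>n. 0 \<le> q n \<and> q n \<le> 1 \<and> (tail p n > 0 \<longrightarrow> q n = p (n + 1) / tail p n))"

definition chain_kernel :: "(nat \<Rightarrow> real) \<Rightarrow> nat \<Rightarrow> nat pmf" where
  "chain_kernel q n = map_pmf (\<lambda>reset. if reset then 0 else n + 1) (bernoulli_pmf (q n))"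

definition transition_op :: "(nat \<Rightarrow> real) \<Rightarrow> nat pmf \<Rightarrow> nat pmf" where
  "transition_op q \<mu> = bind_pmf \<mu> (chain_kernel q)"

text \<open>
  The total variation norm of \<open>\<mu> - \<nu>\<close>, with the factor 2 making it the \<open>\<ell>\<^sup>1\<close> norm of the
  difference of the mass functions.
\<close>

definition tv_norm_diff :: "'a pmf \<Rightarrow> 'a pmf \<Rightarrow> real" where
  "tv_norm_diff \<mu> \<nu> = 2 * (SUP A. \<bar>measure_pmf.prob \<mu> A - measure_pmf.prob \<nu> A\<bar>)"

text \<open>
  \<open>M(n) = 1 + \<integral>\<^sub>1\<^sup>n \<rho>(t) dt\<close> as an extended real: a regularly varying function need not be
  locally integrable on all of \<open>[1,\<infinity>)\<close>.
\<close>

definition trunc_mean :: "(real \<Rightarrow> real) \<Rightarrow> nat \<Rightarrow> ennreal" where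
  "trunc_mean \<rho> n = 1 + (\<integral>\<^sup>+t\<in>{1..real n}. ennreal (\<rho> t) \<partial>lebesgue)"

text \<open>
  The restriction on \<open>(n, \<ell>)\<close>. If \<open>M(n) = \<infinity>\<close> then \<open>M(n)\<close> to the power \<open>-3/2\<close> is \<open>0\<close> and no
  \<open>\<ell> \<ge> 1\<close> is admissible; finiteness is stated explicitly instead of relying on the
  value of \<open>enn2real \<infinity>\<close>.
\<close>

definition admissible :: "real \<Rightarrow> (real \<Rightarrow> real) \<Rightarrow> nat \<Rightarrow> nat \<Rightarrow> bool" where
  "admissible \<alpha> \<rho> n l \<longleftrightarrow>
     (\<alpha> = 1 \<longrightarrow> trunc_mean \<rho> n < \<infinity> \<and>
        real l \<le> \<rho> (real n) * real n powr (3/2) * enn2real (trunc_mean \<rho> n) powr (-3/2)) \<and>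
     (1 < \<alpha> \<and> \<alpha> < 3/2 \<longrightarrow> real l \<le> \<rho> (real n) * real n powr (3/2))"

end

(*
  Let f be the generating function of the return time law, z its tails and U = 1 / (1 - f) the
  renewal series. The mass of P^n delta_0 at j is U_(n-j) z_j, so the total variation distance is
  the z-weighted norm of (1 - X^l) U at time n + l. Put V = ((1 + f) / 2)^m and split
  U = (1 - V) U + V U. The first part contributes at most twice the probability that a sum of m
  lazy steps exceeds n. The second one contributes at most the l^1 norm of (1 - X^l) V, because
  the z-weighted norm of U is 1. Since (1 + f) / 2 has an atom at 0 and, after the gcd condition,
  atoms whose locations generate the integers, that norm is O(l / sqrt m); the laziness removes any
  need for aperiodicity of the differences of the atoms. Chebyshev's inequality for the steps
  truncated at n and Karamata's estimates bound the tail probability by O(m rho(n)), as long as m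
  times the truncated mean is at most n. The choice m ~ (l / rho(n))^(2/3) balances both errors.
*)
theory Submission
  imports Defs "HOL-Computational_Algebra.Polynomial_FPS"
begin

text \<open>The constant must serve all laws \<open>p\<close> at once. Hence the tails enter only
  through z_j \<le> 1 and z_j \<le> \<rho>(j), the thresholds in the estimates depend on \<rho>
  alone, and the gcd condition acts through the finitely many sets of atoms inside {1..N}. Norms are
  cut off at a finite index, so all identities are identities of formal series and no convergence
  has to be discussed. Truncating one step at n costs at most z_n. The truncated second moment is
  O(n^2 \<rho>(n)) because \<alpha> < 2, so Chebyshev's inequality at a distance of order n costs
  another multiple of m \<rho>(n). The mean of the sum must therefore stay well below n, and the
  restriction on l encodes this: with m ~ (l / \<rho>(n))^(2/3), the truncated mean may be at most
  of order n / m. It is bounded for \<alpha> > 1 and O(M(n)) for \<alpha> = 1. For \<alpha> < 1 it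
  is O(n \<rho>(n)), and the requirement becomes l^(2/3) \<rho>(n)^(1/3) = O(1); beyond that range
  the claim is trivial, since the distance never exceeds 2.\<close>

section \<open>Regularly varying functions\<close>

text \<open>The indicators of the sets \<open>V b n\<close> converge pointwise to that of
  \<open>{1..b}\<close>, and dominated convergence passes this on to the measures. The limit runs
  along a sequence \<open>y\<close> because a sequence of bad points will be put in.\<close>

lemma slowly_varying_in_measure:
  fixes G :: "real \<Rightarrow> real" and y :: "nat \<Rightarrow> real"
  assumes meas: "G \<in> borel_measurable lebesgue"
    and lim: "\<And>v. v \<ge> 1 \<Longrightarrow> ((\<lambda>x. G (v * x) - G x) \<longlongrightarrow> 0) at_top"
    and y: "filterlim y at_top sequentially" and "\<epsilon> > 0"
  defines "V \<equiv> \<lambda>b n. {v \<in> {1..b}. \<bar>G (v * y n) - G (y n)\<bar> < \<epsilon>}"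
  shows "V b n \<in> sets lebesgue" and "(\<lambda>n. measure lebesgue (V b n)) \<longlonglongrightarrow> measure lebesgue {1..b}"
proof -
  have V: "V b n \<in> sets lebesgue" for n
  proof -
    have "(\<lambda>v. y n *\<^sub>R v) \<in> lebesgue \<rightarrow>\<^sub>M lebesgue"
      by (rule lebesgue_measurable_scaling)
    then have "G \<circ> (\<lambda>v. y n *\<^sub>R v) \<in> borel_measurable lebesgue"
      using meas by (rule measurable_comp)
    then have m: "(\<lambda>v. G (v * y n)) \<in> borel_measurable lebesgue"
      by (simp add: o_def mult.commute)
    have "V b n = {1..b} \<inter> {v \<in> space lebesgue. \<bar>G (v * y n) - G (y n)\<bar> < \<epsilon>}"
      by (auto simp: V_def)
    also have "\<dots> \<in> sets lebesgue"
    proof (rule sets.Int)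
      have "(\<lambda>v. \<bar>G (v * y n) - G (y n)\<bar>) \<in> borel_measurable lebesgue"
        by (intro borel_measurable_abs borel_measurable_diff m) auto
      then show "{v \<in> space lebesgue. \<bar>G (v * y n) - G (y n)\<bar> < \<epsilon>} \<in> sets lebesgue"
        unfolding borel_measurable_iff_less by blast
    qed simp
    finally show ?thesis .
  qed
  then show "V b n \<in> sets lebesgue" .
  have fin: "emeasure lebesgue (V b n) < \<infinity>" for n
  proof -
    have "emeasure lebesgue (V b n) \<le> emeasure lebesgue {1..b}"
      by (rule emeasure_mono) (auto simp: V_def)
    also have "\<dots> < \<infinity>" by (simp add: emeasure_lborel_Icc_eq)
    finally show ?thesis .
  qed
  have "(\<lambda>n. \<integral>v. indicator (V b n) v \<partial>lebesgue) \<longlonglongrightarrow> (\<integral>v. indicat_real {1..b} v \<partial>lebesgue)"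
  proof (rule integral_dominated_convergence[where w = "indicat_real {1..b}"])
    show "integrable lebesgue (indicat_real {1..b})"
      by (rule integrable_real_indicator) (auto simp: emeasure_lborel_Icc_eq)
    show "AE v in lebesgue. (\<lambda>n. indicat_real (V b n) v) \<longlonglongrightarrow> indicat_real {1..b} v"
    proof (rule AE_I2)
      fix v :: real
      show "(\<lambda>n. indicat_real (V b n) v) \<longlonglongrightarrow> indicat_real {1..b} v"
      proof (cases "v \<in> {1..b}")
        case True
        then have "(\<lambda>n. G (v * y n) - G (y n)) \<longlonglongrightarrow> 0"
          by (intro filterlim_compose[OF lim y]) auto
        then have "eventually (\<lambda>n. dist (G (v * y n) - G (y n)) 0 < \<epsilon>) sequentially"
          using \<open>\<epsilon> > 0\<close> by (rule tendstoD)
        then have "eventually (\<lambda>n. v \<in> V b n) sequentially"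
          by eventually_elim (use True in \<open>auto simp: V_def dist_real_def\<close>)
        then have "eventually (\<lambda>n. indicat_real (V b n) v = indicat_real {1..b} v) sequentially"
          by eventually_elim (use True in auto)
        then show ?thesis by (rule tendsto_eventually)
      next
        case False
        then have "v \<notin> V b n" for n by (auto simp: V_def)
        with False show ?thesis by simp
      qed
    qed
    show "AE v in lebesgue. norm (indicat_real (V b n) v) \<le> indicat_real {1..b} v" for n
      by (rule AE_I2) (auto simp: V_def indicator_def)
  qed (use V in \<open>auto intro!: borel_measurable_indicator\<close>)
  then show "(\<lambda>n. measure lebesgue (V b n)) \<longlonglongrightarrow> measure lebesgue {1..b}"
    using V fin by simp
qed

text \<open>
  The classical argument for uniform convergence: for a bad pair \<open>x\<close>, \<open>\<mu> x\<close> the sets of \<open>v\<close> for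
  which \<open>G (v x)\<close> is close to \<open>G x\<close> respectively to \<open>G (\<mu> x)\<close> are both too large to be disjoint.
\<close>

lemma slowly_varying_uniform:
  fixes G :: "real \<Rightarrow> real"
  assumes meas: "G \<in> borel_measurable lebesgue"
    and lim: "\<And>v. v \<ge> 1 \<Longrightarrow> ((\<lambda>x. G (v * x) - G x) \<longlongrightarrow> 0) at_top"
    and "\<epsilon> > 0"
  shows "\<exists>X\<ge>1. \<forall>x\<ge>X. \<forall>\<mu>\<in>{1..2}. \<bar>G (\<mu> * x) - G x\<bar> < \<epsilon>"
proof (rule ccontr)
  assume "\<not> ?thesis"
  then have "\<forall>n. \<exists>x \<mu>. x \<ge> real n + 1 \<and> \<mu> \<in> {1..2} \<and> \<bar>G (\<mu> * x) - G x\<bar> \<ge> \<epsilon>"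
    by (smt (verit) of_nat_0_le_iff)
  then obtain x \<mu> where x: "\<And>n. x n \<ge> real n + 1" and \<mu>: "\<And>n. \<mu> n \<in> {1..2}"
    and bad: "\<And>n. \<bar>G (\<mu> n * x n) - G (x n)\<bar> \<ge> \<epsilon>"
    by metis
  \<comment> \<open>As \<mu> n \<le> 2, scaling \<open>W n\<close> by \<mu> n keeps it inside
    [1, 8]. The measures tend to 7 and 3, so eventually they exceed 6 and 2: too much for disjoint
    subsets of an interval of length 7.\<close>
  define V where "V n = {v \<in> {1..8}. \<bar>G (v * x n) - G (x n)\<bar> < \<epsilon> / 2}" for n
  define W where "W n = {w \<in> {1..4}. \<bar>G (w * (\<mu> n * x n)) - G (\<mu> n * x n)\<bar> < \<epsilon> / 2}" for n
  have lx: "filterlim x at_top sequentially"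
    by (rule filterlim_at_top_mono[OF filterlim_real_sequentially])
       (use x in \<open>smt (verit) always_eventually\<close>)
  have "\<mu> n * x n \<ge> real n" for n
    using x[of n] \<mu>[of n] mult_mono[of 1 "\<mu> n" "real n" "x n"] by auto
  then have lmx: "filterlim (\<lambda>n. \<mu> n * x n) at_top sequentially"
    by (intro filterlim_at_top_mono[OF filterlim_real_sequentially] always_eventually) auto
  have e2: "\<epsilon> / 2 > 0" using \<open>\<epsilon> > 0\<close> by simp
  note mV = slowly_varying_in_measure[OF meas lim lx e2, where b = 8, folded V_def]
  note mW = slowly_varying_in_measure[OF meas lim lmx e2, where b = 4, folded W_def]
  have Vm: "V n \<in> sets lebesgue" and Wm: "W n \<in> sets lebesgue" for n
    by (rule mV(1) mW(1), assumption)+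
  have "(\<lambda>n. measure lebesgue (V n)) \<longlonglongrightarrow> measure lebesgue {1..8::real}"
    by (rule mV(2))
  then have "(\<lambda>n. measure lebesgue (V n)) \<longlonglongrightarrow> 7" by simp
  moreover have "(\<lambda>n. measure lebesgue (W n)) \<longlonglongrightarrow> measure lebesgue {1..4::real}"
    by (rule mW(2))
  then have "(\<lambda>n. measure lebesgue (W n)) \<longlonglongrightarrow> 3" by simp
  ultimately have "eventually (\<lambda>n. measure lebesgue (V n) > 6) sequentially"
    "eventually (\<lambda>n. measure lebesgue (W n) > 2) sequentially"
    by (auto intro: order_tendstoD)
  then have "eventually (\<lambda>n. measure lebesgue (V n) > 6 \<and> measure lebesgue (W n) > 2) sequentially"
    by (rule eventually_conj)
  then obtain n where V6: "measure lebesgue (V n) > 6" and W2: "measure lebesgue (W n) > 2"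
    by (auto simp: eventually_sequentially)
  \<comment> \<open>The scaling turns multiples of \<mu> n * x n into multiples of x n, and it loses
    no measure since \<mu> n \<ge> 1.\<close>
  define W' where "W' = (\<lambda>w. \<mu> n * w) ` W n"
  have W'm: "W' \<in> sets lebesgue"
  proof -
    have "W' = (\<lambda>v. (1 / \<mu> n) *\<^sub>R v) -` W n \<inter> space lebesgue"
      using \<mu>[of n] by (auto simp: W'_def intro: rev_image_eqI)
    then show ?thesis
      using measurable_sets[OF lebesgue_measurable_scaling Wm] by metis
  qed
  have fin: "S \<in> lmeasurable" if "S \<in> sets lebesgue" "S \<subseteq> {1..8}" for S :: "real set"
    using that by (meson bounded_closed_interval bounded_set_imp_lmeasurable bounded_subset)
  have W'sub: "W' \<subseteq> {1..8}"
  proof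
    fix v assume "v \<in> W'"
    then obtain w where "v = \<mu> n * w" "1 \<le> w" "w \<le> 4" by (auto simp: W'_def W_def)
    with \<mu>[of n] show "v \<in> {1..8}"
      using mult_mono[of 1 "\<mu> n" 1 w] mult_mono[of "\<mu> n" 2 w 4] by auto
  qed
  have "measure lebesgue W' = \<mu> n * measure lebesgue (W n)"
    using measure_lebesgue_affine[of "\<mu> n" 0 "W n"] \<mu>[of n] by (simp add: W'_def)
  then have W'2: "measure lebesgue W' > 2"
    using W2 \<mu>[of n] by (smt (verit) atLeastAtMost_iff mult_le_cancel_right1)
  have Vsub: "V n \<subseteq> {1..8}" by (auto simp: V_def)
  have "V n \<inter> W' \<noteq> {}"
  proof
    assume "V n \<inter> W' = {}"
    then have "measure lebesgue (V n \<union> W') = measure lebesgue (V n) + measure lebesgue W'"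
      using fin[OF Vm Vsub] fin[OF W'm W'sub] by (intro measure_Un3[THEN trans]) auto
    moreover have "measure lebesgue (V n \<union> W') \<le> measure lebesgue {1..8::real}"
      using Vsub W'sub Vm W'm by (intro measure_mono_fmeasurable) auto
    ultimately show False using V6 W'2 by simp
  qed
  then obtain w where w: "w \<in> W n" "\<mu> n * w \<in> V n" by (auto simp: W'_def)
  then have "\<bar>G (w * (\<mu> n * x n)) - G (\<mu> n * x n)\<bar> < \<epsilon> / 2"
    "\<bar>G (w * (\<mu> n * x n)) - G (x n)\<bar> < \<epsilon> / 2"
    by (auto simp: V_def W_def mult_ac)
  with bad[of n] show False by linarith
qed

text \<open>From x to y there are about log_2(y / x) steps, each multiplying by a factor in [1, 2].
  Uniform convergence allows an error \<epsilon> per step, and these errors add up.\<close>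

lemma potter_bounds:
  fixes \<rho> :: "real \<Rightarrow> real"
  assumes rv: "regularly_varying 1 \<beta> \<rho>" and "\<delta> > 0"
  shows "\<exists>X\<ge>1. \<forall>x\<ge>X. \<forall>y\<ge>x.
           \<bar>ln (\<rho> y) - ln (\<rho> x) - \<beta> * ln (y / x)\<bar> \<le> \<delta> * (1 + ln (y / x))"
proof -
  \<comment> \<open>The logarithm of the slowly varying part. The indicator extends \<rho>, which is
    measurable only on [1, \<infinity>), to a measurable function on the line.\<close>
  define G where "G x = ln (indicator {1..} x *\<^sub>R \<rho> x) - \<beta> * ln x" for x
  have pos: "\<rho> x > 0" if "x \<ge> 1" for x
    using rv that by (auto simp: regularly_varying_def)
  have G: "G x = ln (\<rho> x) - \<beta> * ln x" if "x \<ge> 1" for x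
    using that by (simp add: G_def)
  have "(\<lambda>x. indicator {1..} x *\<^sub>R \<rho> x) \<in> borel_measurable lebesgue"
    by (rule borel_measurable_restrict_space_iff[THEN iffD1])
       (use rv in \<open>simp_all add: regularly_varying_def\<close>)
  then have meas: "G \<in> borel_measurable lebesgue"
    unfolding G_def
    by (intro borel_measurable_diff borel_measurable_ln borel_measurable_times
        borel_measurable_const) (simp_all add: measurable_completion)
  have lim: "((\<lambda>x. G (v * x) - G x) \<longlongrightarrow> 0) at_top" if "v \<ge> 1" for v
  proof -
    have "((\<lambda>x. \<rho> (v * x) / \<rho> x) \<longlongrightarrow> v powr \<beta>) at_top"
      using rv that by (auto simp: regularly_varying_def)
    then have "((\<lambda>x. ln (\<rho> (v * x) / \<rho> x) - \<beta> * ln v) \<longlongrightarrow> ln (v powr \<beta>) - \<beta> * ln v) at_top"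
      using that by (intro tendsto_intros) auto
    then have "((\<lambda>x. ln (\<rho> (v * x) / \<rho> x) - \<beta> * ln v) \<longlongrightarrow> 0) at_top"
      using that by (simp add: ln_powr)
    moreover have "eventually (\<lambda>x. ln (\<rho> (v * x) / \<rho> x) - \<beta> * ln v = G (v * x) - G x) at_top"
    proof (rule eventually_mono[OF eventually_ge_at_top[of 1]])
      fix x :: real assume "x \<ge> 1"
      with that have "v * x \<ge> 1" using mult_mono[of 1 v 1 x] by simp
      with \<open>x \<ge> 1\<close> that show "ln (\<rho> (v * x) / \<rho> x) - \<beta> * ln v = G (v * x) - G x"
        using pos[of x] pos[of "v * x"] by (simp add: G ln_div ln_mult algebra_simps)
    qed
    ultimately show ?thesis by (rule Lim_transform_eventually)
  qed
  \<comment> \<open>The factor ln 2 converts the number log_2(y / x) of doublings into ln(y /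
    x).\<close>
  define \<epsilon> where "\<epsilon> = \<delta> * ln 2"
  have "\<epsilon> > 0" using \<open>\<delta> > 0\<close> by (simp add: \<epsilon>_def)
  from slowly_varying_uniform[OF meas lim this] obtain X where "X \<ge> 1"
    and X: "\<And>x \<mu>. x \<ge> X \<Longrightarrow> \<mu> \<in> {1..2} \<Longrightarrow> \<bar>G (\<mu> * x) - G x\<bar> < \<epsilon>" by blast
  have iter: "\<bar>G (\<mu> * x) - G x\<bar> \<le> \<epsilon> * real i" if "1 \<le> \<mu>" "\<mu> \<le> 2 ^ i" "x \<ge> X" for \<mu> x i
    using that(1,2)
  proof (induction i arbitrary: \<mu>)
    case (Suc i)
    show ?case
    proof (cases "\<mu> \<le> 2")
      case True
      then have "\<bar>G (\<mu> * x) - G x\<bar> \<le> \<epsilon>" using X[of x \<mu>] Suc that by auto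
      also have "\<dots> \<le> \<epsilon> * real (Suc i)" using \<open>\<epsilon> > 0\<close> by simp
      finally show ?thesis .
    next
      case False
      then have *: "\<bar>G (\<mu> / 2 * x) - G x\<bar> \<le> \<epsilon> * real i" using Suc by (intro Suc.IH) auto
      have "\<mu> / 2 * x \<ge> X"
        using False \<open>x \<ge> X\<close> \<open>X \<ge> 1\<close> mult_mono[of 1 "\<mu> / 2" X x] by auto
      then have "\<bar>G (2 * (\<mu> / 2 * x)) - G (\<mu> / 2 * x)\<bar> < \<epsilon>" by (intro X) auto
      with * show ?thesis by (simp add: algebra_simps)
    qed
  qed simp
  show ?thesis
  proof (intro exI[of _ X] conjI allI impI)
    fix x y assume xy: "X \<le> x" "x \<le> y"
    define i where "i = nat \<lceil>log 2 (y / x)\<rceil>"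
    have x1: "x \<ge> 1" "y \<ge> 1" "y / x \<ge> 1" using xy \<open>X \<ge> 1\<close> by auto
    then have l0: "log 2 (y / x) \<ge> 0" by simp
    have "y / x = 2 powr log 2 (y / x)" using x1 by simp
    also have "\<dots> \<le> 2 powr real i" by (intro powr_mono) (auto simp: i_def real_nat_ceiling_ge)
    finally have "y / x \<le> 2 ^ i" by (simp add: powr_realpow)
    from iter[OF x1(3) this xy(1)] have "\<bar>G y - G x\<bar> \<le> \<epsilon> * real i" using x1 by simp
    also have "\<dots> \<le> \<epsilon> * (1 + log 2 (y / x))"
      using l0 \<open>\<epsilon> > 0\<close> by (intro mult_left_mono) (auto simp: i_def, linarith)
    also have "\<dots> = \<delta> * (ln 2 + ln (y / x))"
      by (simp add: \<epsilon>_def log_def algebra_simps)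
    also have "\<dots> \<le> \<delta> * (1 + ln (y / x))"
      using \<open>\<delta> > 0\<close> ln_2_less_1 by (intro mult_left_mono) auto
    finally show "\<bar>ln (\<rho> y) - ln (\<rho> x) - \<beta> * ln (y / x)\<bar> \<le> \<delta> * (1 + ln (y / x))"
      using x1 by (simp add: G ln_div algebra_simps)
  qed (rule \<open>X \<ge> 1\<close>)
qed


text \<open>Exponentiating costs the constant exp \<delta>. The first form bounds later values and
  serves convergent sums; the second bounds earlier values by the last one and serves growing
  sums.\<close>

lemma potter_powr:
  fixes \<rho> :: "real \<Rightarrow> real"
  assumes rv: "regularly_varying 1 \<beta> \<rho>" and "\<delta> > 0"
  shows "\<exists>K\<ge>1. \<exists>X\<ge>1. \<forall>x\<ge>X. \<forall>y\<ge>x. \<rho> y \<le> K * \<rho> x * (y / x) powr (\<beta> + \<delta>)"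
    and "\<exists>K\<ge>1. \<exists>X\<ge>1. \<forall>x\<ge>X. \<forall>y\<ge>x. \<rho> x \<le> K * \<rho> y * (y / x) powr (\<delta> - \<beta>)"
proof -
  from potter_bounds[OF assms] obtain X where "X \<ge> 1"
    and X: "\<And>x y. X \<le> x \<Longrightarrow> x \<le> y \<Longrightarrow>
      \<bar>ln (\<rho> y) - ln (\<rho> x) - \<beta> * ln (y / x)\<bar> \<le> \<delta> * (1 + ln (y / x))" by blast
  have pos: "\<rho> x > 0" if "x \<ge> 1" for x
    using rv that by (auto simp: regularly_varying_def)
  have up: "u \<le> exp \<delta> * v * w powr \<eta>"
    if "u > 0" "v > 0" "w > 0" "ln u \<le> \<delta> + ln v + \<eta> * ln w" for u v w \<eta> :: real
  proof -
    have "ln u \<le> ln (exp \<delta> * v * w powr \<eta>)"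
      using that by (simp add: ln_mult ln_powr)
    then show ?thesis using that by (subst (asm) ln_le_cancel_iff) auto
  qed
  have *: "\<rho> x > 0" "\<rho> y > 0" "y / x > 0" if "X \<le> x" "x \<le> y" for x y
    using that \<open>X \<ge> 1\<close> by (auto intro: pos)
  have "\<rho> y \<le> exp \<delta> * \<rho> x * (y / x) powr (\<beta> + \<delta>)" if "X \<le> x" "x \<le> y" for x y
    by (rule up[OF *(2,1,3)[OF that]]) (use X[OF that] in \<open>simp add: algebra_simps\<close>)
  moreover have "\<rho> x \<le> exp \<delta> * \<rho> y * (y / x) powr (\<delta> - \<beta>)" if "X \<le> x" "x \<le> y" for x y
    by (rule up[OF *[OF that]]) (use X[OF that] in \<open>simp add: algebra_simps\<close>)
  moreover have "exp \<delta> \<ge> 1" using \<open>\<delta> > 0\<close> by simp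
  ultimately show "\<exists>K\<ge>1. \<exists>X\<ge>1. \<forall>x\<ge>X. \<forall>y\<ge>x. \<rho> y \<le> K * \<rho> x * (y / x) powr (\<beta> + \<delta>)"
    and "\<exists>K\<ge>1. \<exists>X\<ge>1. \<forall>x\<ge>X. \<forall>y\<ge>x. \<rho> x \<le> K * \<rho> y * (y / x) powr (\<delta> - \<beta>)"
    using \<open>X \<ge> 1\<close> by blast+
qed

section \<open>Sums of tails dominated by a regularly varying function\<close>

lemma sum_powr_le:
  fixes \<gamma> :: real
  assumes "-1 < \<gamma>" "\<gamma> \<le> 0"
  shows "(\<Sum>i=1..n. real i powr \<gamma>) \<le> real n powr (\<gamma> + 1) / (\<gamma> + 1)"
proof (induction n)
  case (Suc n)
  have "real (Suc n) powr \<gamma> \<le> (real (Suc n) powr (\<gamma> + 1) - real n powr (\<gamma> + 1)) / (\<gamma> + 1)"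
  \<comment> \<open>The power need not be differentiable at 0; there the claim is just 1 \<le> 1 /
    (\<gamma> + 1).\<close>
  proof (cases "n = 0")
    case True
    then show ?thesis using assms by (simp add: field_simps)
  next
    case False
    have "\<exists>z>real n. z < real (Suc n) \<and>
        real (Suc n) powr (\<gamma> + 1) - real n powr (\<gamma> + 1)
          = (real (Suc n) - real n) * ((\<gamma> + 1) * z powr \<gamma>)"
    proof (rule MVT2)
      fix x assume "real n \<le> x"
      then have "x > 0" using False by (smt (verit) of_nat_0_less_iff not_gr_zero)
      then show "((\<lambda>x. x powr (\<gamma> + 1)) has_real_derivative (\<gamma> + 1) * x powr \<gamma>) (at x)"
        by (auto intro!: derivative_eq_intros)
    qed simp
    then obtain z where z: "z > real n" "z < real (Suc n)" and
      e: "real (Suc n) powr (\<gamma> + 1) - real n powr (\<gamma> + 1) = (\<gamma> + 1) * z powr \<gamma>" by auto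
    have "real (Suc n) powr \<gamma> \<le> z powr \<gamma>"
      using z assms by (intro powr_mono2') auto
    then show ?thesis unfolding e using assms by simp
  qed
  then show ?case using Suc by (simp add: diff_divide_distrib)
qed simp

text \<open>The last terms dominate: z_j is at most a constant times \<rho>(n) (n / j)^\<theta> with
  \<theta> < \<kappa> + 1, and j^(\<kappa> - \<theta>) sums to order n^(\<kappa> - \<theta> + 1).
  The case \<kappa> = 0 serves truncated means, \<kappa> = 1 truncated second moments.\<close>

lemma karamata_tail_sum:
  fixes \<rho> :: "real \<Rightarrow> real" and \<kappa> :: real
  assumes rv: "regularly_varying 1 (- \<alpha>) \<rho>" and "\<alpha> < \<kappa> + 1" "\<kappa> \<ge> 0"
  shows "\<exists>K. \<forall>z n. (\<forall>j. z j \<le> 1) \<and> (\<forall>j\<ge>1. z j \<le> \<rho> (real j)) \<and> n \<ge> 1 \<longrightarrow>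
            (\<Sum>j<n. real (j + 1) powr \<kappa> * z j) \<le> K * real n powr (\<kappa> + 1) * \<rho> (real n)"
proof -
  \<comment> \<open>Potter's bound requires \<theta> > \<alpha>, the growth of the sum \<theta> <
    \<kappa> + 1, and \<open>sum_powr_le\<close> a nonpositive exponent \<kappa> - \<theta>.\<close>
  define \<theta> where "\<theta> = max ((\<alpha> + \<kappa> + 1) / 2) \<kappa>"
  have \<theta>: "\<alpha> < \<theta>" "\<theta> < \<kappa> + 1" "\<kappa> \<le> \<theta>" "\<theta> \<ge> 0" using assms by (auto simp: \<theta>_def less_max_iff_disj)
  have pos: "\<rho> x > 0" if "x \<ge> 1" for x
    using rv that by (auto simp: regularly_varying_def)
  obtain E X where e1: "E \<ge> 1" and "X \<ge> 1" and
    X: "\<And>x y. X \<le> x \<Longrightarrow> x \<le> y \<Longrightarrow> \<rho> x \<le> E * \<rho> y * (y / x) powr \<theta>"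
    using potter_powr(2)[OF rv, of "\<theta> - \<alpha>"] \<theta> by fastforce
  define J where "J = nat \<lceil>X\<rceil>"
  have "real J \<ge> X" by (simp add: J_def real_nat_ceiling_ge)
  then have J1: "J \<ge> 1" using \<open>X \<ge> 1\<close> by (cases J) auto
  define a where "a = Min ((\<lambda>j. min 1 (\<rho> (real j))) ` {1..J})"
  have "a \<in> (\<lambda>j. min 1 (\<rho> (real j))) ` {1..J}"
    unfolding a_def using J1 by (intro Min_in) auto
  then have "a > 0" using pos by auto
  have a: "a \<le> \<rho> (real j)" "a \<le> 1" if "1 \<le> j" "j \<le> J" for j
  proof -
    have "a \<le> min 1 (\<rho> (real j))" unfolding a_def using that by (intro Min_le imageI finite_imageI) auto
    then show "a \<le> \<rho> (real j)" "a \<le> 1" by auto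
  qed
  define K where "K = 2 powr \<theta> * (E / a)"
  \<comment> \<open>Up to the threshold \<open>J\<close> only z_j \<le> 1 helps, so 1 itself must
    lie below the target: for n \<le> J through the minimum \<open>a\<close> of finitely many
    values, for larger n through Potter's bound from \<open>J\<close> to n.\<close>
  have low: "1 \<le> E / a * \<rho> (real n) * (real n / real j) powr \<theta>"
    if "1 \<le> j" "j \<le> n" "j \<le> J" for j n
  proof -
    have j1: "(real n / real j) powr \<theta> \<ge> 1" using that \<theta> by (intro ge_one_powr_ge_zero) auto
    show ?thesis
    proof (cases "n \<le> J")
      case True
      have "1 \<le> \<rho> (real n) / a" using a(1)[of n] that True \<open>a > 0\<close> by simp
      then have "1 * 1 * 1 \<le> E * (\<rho> (real n) / a) * (real n / real j) powr \<theta>"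
        using e1 j1 by (intro mult_mono mult_nonneg_nonneg) linarith+
      then show ?thesis by simp
    next
      case False
      have "a \<le> E * \<rho> (real n) * (real n / real J) powr \<theta>"
        using X[of "real J" "real n"] a(1)[of J] J1 False \<open>real J \<ge> X\<close> by auto
      also have "\<dots> \<le> E * \<rho> (real n) * (real n / real j) powr \<theta>"
        using that \<theta> J1 pos[of "real n"] e1 by (intro mult_left_mono powr_mono2 divide_left_mono) auto
      finally show ?thesis using \<open>a > 0\<close> by (simp add: field_simps)
    qed
  qed
  have bound: "z j \<le> K * \<rho> (real n) * (real n / real (j + 1)) powr \<theta>"
    if z: "\<forall>j. z j \<le> 1" "\<forall>j\<ge>1. z j \<le> \<rho> (real j)" and "j < n" for z :: "nat \<Rightarrow> real" and j n
  proof -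
    \<comment> \<open>At j = 0 there is no value of \<rho> to compare with, so 0 is treated like 1.
      Passing from i to j + 1 costs the factor 2^\<theta>.\<close>
    define i where "i = max 1 j"
    have i: "i \<ge> 1" "i \<le> n" "j + 1 \<le> 2 * i" using \<open>j < n\<close> by (auto simp: i_def)
    have rn: "\<rho> (real n) > 0" using i by (intro pos) auto
    have "z j \<le> E / a * \<rho> (real n) * (real n / real i) powr \<theta>"
    proof (cases "i \<le> J")
      case True
      then show ?thesis using low[of i n] i z(1) by (meson order_trans)
    next
      case False
      then have "i = j" using J1 by (auto simp: i_def)
      then have "z j \<le> \<rho> (real i)" using z(2) i by auto
      also have "\<dots> \<le> E * \<rho> (real n) * (real n / real i) powr \<theta>"
        using False \<open>real J \<ge> X\<close> i by (intro X) auto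
      also have "\<dots> \<le> E / a * \<rho> (real n) * (real n / real i) powr \<theta>"
        using a(2)[of 1] J1 \<open>a > 0\<close> rn e1 by (intro mult_right_mono) (auto simp: field_simps)
      finally show ?thesis .
    qed
    also have "\<dots> \<le> E / a * \<rho> (real n) * (2 powr \<theta> * (real n / real (j + 1)) powr \<theta>)"
    proof (intro mult_left_mono)
      have "(real n / real i) powr \<theta> \<le> (2 * (real n / real (j + 1))) powr \<theta>"
      proof (intro powr_mono2)
        have "real (j + 1) \<le> 2 * real i" using i(3) by linarith
        then have "real n * real (j + 1) \<le> real n * (2 * real i)" by (intro mult_left_mono) auto
        then show "real n / real i \<le> 2 * (real n / real (j + 1))"
          using i by (simp add: field_simps)
      qed (use \<theta> in auto)
      also have "\<dots> = 2 powr \<theta> * (real n / real (j + 1)) powr \<theta>"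
        by (subst powr_mult) auto
      finally show "(real n / real i) powr \<theta> \<le> 2 powr \<theta> * (real n / real (j + 1)) powr \<theta>" .
    qed (use rn \<open>a > 0\<close> e1 in auto)
    finally show ?thesis by (simp add: K_def mult_ac)
  qed
  show ?thesis
  proof (intro exI[of _ "K / (\<kappa> - \<theta> + 1)"] allI impI)
    fix z :: "nat \<Rightarrow> real" and n :: nat
    assume *: "(\<forall>j. z j \<le> 1) \<and> (\<forall>j\<ge>1. z j \<le> \<rho> (real j)) \<and> n \<ge> 1"
    then have "K > 0" "\<rho> (real n) > 0" using pos \<open>a > 0\<close> e1 by (auto simp: K_def)
    have "(\<Sum>j<n. real (j + 1) powr \<kappa> * z j)
        \<le> (\<Sum>j<n. real (j + 1) powr \<kappa> * (K * \<rho> (real n) * (real n / real (j + 1)) powr \<theta>))"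
      using * by (intro sum_mono mult_left_mono bound) auto
    also have "\<dots> = (\<Sum>j<n. K * \<rho> (real n) * real n powr \<theta> * real (j + 1) powr (\<kappa> - \<theta>))"
      by (intro sum.cong) (auto simp: powr_divide powr_diff)
    also have "\<dots> = K * \<rho> (real n) * real n powr \<theta> * (\<Sum>i=1..n. real i powr (\<kappa> - \<theta>))"
      by (simp add: sum_distrib_left sum.atLeast1_atMost_eq)
    also have "\<dots> \<le> K * \<rho> (real n) * real n powr \<theta> * (real n powr (\<kappa> - \<theta> + 1) / (\<kappa> - \<theta> + 1))"
      using \<open>K > 0\<close> \<open>\<rho> (real n) > 0\<close> \<theta> by (intro mult_left_mono sum_powr_le) auto
    also have "\<dots> = K / (\<kappa> - \<theta> + 1) * real n powr (\<kappa> + 1) * \<rho> (real n)"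
      by (simp flip: powr_add)
    finally show "(\<Sum>j<n. real (j + 1) powr \<kappa> * z j)
        \<le> K / (\<kappa> - \<theta> + 1) * real n powr (\<kappa> + 1) * \<rho> (real n)" .
  qed
qed

text \<open>Potter's bound with 1 < \<theta> < \<alpha> gives one summable majorant \<open>w\<close>
  for all such z: terms before the threshold are at most 1, later ones at most B
  j^(-\<theta>).\<close>

lemma tail_sum_bounded:
  fixes \<rho> :: "real \<Rightarrow> real"
  assumes rv: "regularly_varying 1 (- \<alpha>) \<rho>" and "\<alpha> > 1"
  shows "\<exists>K. \<forall>z n. (\<forall>j. z j \<le> 1) \<and> (\<forall>j\<ge>1. z j \<le> \<rho> (real j)) \<longrightarrow> (\<Sum>j<n. z j) \<le> K"
proof -
  define \<theta> where "\<theta> = (1 + \<alpha>) / 2"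
  have \<theta>: "1 < \<theta>" "\<theta> < \<alpha>" using assms by (auto simp: \<theta>_def)
  have pos: "\<rho> x > 0" if "x \<ge> 1" for x
    using rv that by (auto simp: regularly_varying_def)
  obtain E X where "E \<ge> 1" and "X \<ge> 1" and
    X: "\<And>x y. X \<le> x \<Longrightarrow> x \<le> y \<Longrightarrow> \<rho> y \<le> E * \<rho> x * (y / x) powr (- \<theta>)"
    using potter_powr(1)[OF rv, of "\<alpha> - \<theta>"] \<theta> by fastforce
  define J where "J = nat \<lceil>X\<rceil>"
  have "real J \<ge> X" by (simp add: J_def real_nat_ceiling_ge)
  then have J1: "J \<ge> 1" using \<open>X \<ge> 1\<close> by (cases J) auto
  define B where "B = E * \<rho> (real J) * real J powr \<theta>"
  have "B \<ge> 0" using pos[of "real J"] J1 \<open>E \<ge> 1\<close> by (simp add: B_def)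
  define w where "w j = (if j < J then 1 else 0) + B * real j powr (- \<theta>)" for j
  have sw: "summable w"
    unfolding w_def using \<theta>
    by (intro summable_add summable_mult) (auto simp: summable_real_powr_iff intro: summable_finite[of "{..<J}"])
  have w0: "w j \<ge> 0" for j using \<open>B \<ge> 0\<close> by (auto simp: w_def)
  show ?thesis
  proof (intro exI[of _ "suminf w"] allI impI)
    fix z :: "nat \<Rightarrow> real" and n :: nat
    assume *: "(\<forall>j. z j \<le> 1) \<and> (\<forall>j\<ge>1. z j \<le> \<rho> (real j))"
    have "z j \<le> w j" for j
    proof (cases "j < J")
      case True
      then show ?thesis using * \<open>B \<ge> 0\<close> by (simp add: w_def add_increasing2)
    next
      case False
      then have "z j \<le> \<rho> (real j)" using * J1 by auto
      also have "\<dots> \<le> E * \<rho> (real J) * (real j / real J) powr (- \<theta>)"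
        using False \<open>real J \<ge> X\<close> by (intro X) auto
      also have "\<dots> = B * real j powr (- \<theta>)"
        using J1 by (simp add: B_def powr_divide powr_minus divide_simps)
      finally show ?thesis using False by (simp add: w_def)
    qed
    then have "(\<Sum>j<n. z j) \<le> (\<Sum>j<n. w j)" by (intro sum_mono)
    also have "\<dots> \<le> suminf w" using sw w0 by (intro sum_le_suminf) auto
    finally show "(\<Sum>j<n. z j) \<le> suminf w" .
  qed
qed

text \<open>On [j, j + 1) the argument changes by a factor of at most 2, so beyond a threshold
  \<rho>(j) is at most a constant multiple of \<rho> there, and the sum is compared with the
  integral.\<close>

lemma tail_sum_le_trunc_mean:
  fixes \<rho> :: "real \<Rightarrow> real"
  assumes rv: "regularly_varying 1 \<beta> \<rho>"
  shows "\<exists>K. \<forall>z n. (\<forall>j. z j \<le> 1) \<and> (\<forall>j\<ge>1. z j \<le> \<rho> (real j)) \<and> trunc_mean \<rho> n < \<infinity> \<longrightarrow>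
            (\<Sum>j<n. z j) \<le> K * enn2real (trunc_mean \<rho> n)"
proof -
  have pos: "\<rho> x > 0" if "x \<ge> 1" for x
    using rv that by (auto simp: regularly_varying_def)
  obtain E X where "E \<ge> 1" and "X \<ge> 1" and
    X: "\<And>x y. X \<le> x \<Longrightarrow> x \<le> y \<Longrightarrow> \<rho> x \<le> E * \<rho> y * (y / x) powr (1 - \<beta>)"
    using potter_powr(2)[OF rv, of 1] by fastforce
  define J where "J = nat \<lceil>X\<rceil>"
  have "real J \<ge> X" by (simp add: J_def real_nat_ceiling_ge)
  then have J1: "J \<ge> 1" using \<open>X \<ge> 1\<close> by (cases J) auto
  define B where "B = E * 2 powr \<bar>1 - \<beta>\<bar>"
  have "B > 0" using \<open>E \<ge> 1\<close> by (simp add: B_def)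
  have step: "\<rho> (real j) / B \<le> \<rho> t" if "j \<ge> J" "real j \<le> t" "t < real j + 1" for j t
  proof -
    have j1: "real j \<ge> 1" using that(1) J1 by linarith
    have "\<rho> (real j) \<le> E * \<rho> t * (t / real j) powr (1 - \<beta>)"
      using that \<open>real J \<ge> X\<close> by (intro X) auto
    also have "(t / real j) powr (1 - \<beta>) \<le> (t / real j) powr \<bar>1 - \<beta>\<bar>"
      using that j1 by (intro powr_mono) auto
    also have "\<dots> \<le> 2 powr \<bar>1 - \<beta>\<bar>"
      using that j1 by (intro powr_mono2) (auto simp: field_simps)
    finally show ?thesis
      using pos[of t] that j1 \<open>B > 0\<close> \<open>E \<ge> 1\<close> by (simp add: B_def field_simps mult_left_mono)
  qed
  have int: "ennreal (\<Sum>j=J..<n. \<rho> (real j) / B) \<le> (\<integral>\<^sup>+t\<in>{1..real n}. ennreal (\<rho> t) \<partial>lebesgue)" for n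
  proof -
    have "ennreal (\<Sum>j=J..<n. \<rho> (real j) / B)
        = (\<Sum>j=J..<n. ennreal (\<rho> (real j) / B) * emeasure lebesgue {real j..<real j + 1})"
      using pos \<open>B > 0\<close> J1 by (subst sum_ennreal[symmetric]) (auto intro: less_imp_le)
    also have "\<dots> = (\<integral>\<^sup>+t. (\<Sum>j=J..<n. ennreal (\<rho> (real j) / B) * indicator {real j..<real j + 1} t) \<partial>lebesgue)"
      by (subst nn_integral_sum) (auto simp: nn_integral_cmult_indicator intro!: borel_measurable_times_ennreal borel_measurable_indicator)
    also have "\<dots> \<le> (\<integral>\<^sup>+t\<in>{1..real n}. ennreal (\<rho> t) \<partial>lebesgue)"
    proof (rule nn_integral_mono)
      fix t :: real
      \<comment> \<open>The unit intervals are disjoint, so at most the summand with j =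
        \<open>k\<close> survives.\<close>
      define k where "k = nat \<lfloor>t\<rfloor>"
      have ind: "indicator {real j..<real j + 1} t = (if j = k then 1 else 0 :: ennreal)" if "t \<ge> 0" for j
        using that by (auto simp: k_def indicator_def) linarith+
      show "(\<Sum>j=J..<n. ennreal (\<rho> (real j) / B) * indicator {real j..<real j + 1} t)
          \<le> ennreal (\<rho> t) * indicator {1..real n} t"
      proof (cases "t \<ge> 0 \<and> k \<in> {J..<n}")
        case True
        then have k: "real k \<le> t" "t < real k + 1" by (auto simp: k_def)
        have "(\<Sum>j=J..<n. ennreal (\<rho> (real j) / B) * indicator {real j..<real j + 1} t)
            = ennreal (\<rho> (real k) / B)"
          using True by (simp add: ind if_distrib sum.delta cong: if_cong)
        also have "\<dots> \<le> ennreal (\<rho> t)" using True k by (intro ennreal_leI step) auto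
        finally show ?thesis using True k J1 by simp
      next
        case False
        have "(\<Sum>j=J..<n. ennreal (\<rho> (real j) / B) * indicator {real j..<real j + 1} t) = 0"
        proof (rule sum.neutral, rule ballI)
          fix j assume "j \<in> {J..<n}"
          with False show "ennreal (\<rho> (real j) / B) * indicator {real j..<real j + 1} t = 0"
            by (cases "t \<ge> 0") (auto simp: ind)
        qed
        then show ?thesis by simp
      qed
    qed
    finally show ?thesis .
  qed
  show ?thesis
  proof (intro exI[of _ "real J + B"] allI impI)
    fix z :: "nat \<Rightarrow> real" and n :: nat
    assume *: "(\<forall>j. z j \<le> 1) \<and> (\<forall>j\<ge>1. z j \<le> \<rho> (real j)) \<and> trunc_mean \<rho> n < \<infinity>"
    define I where "I = enn2real (\<integral>\<^sup>+t\<in>{1..real n}. ennreal (\<rho> t) \<partial>lebesgue)"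
    have fin: "(\<integral>\<^sup>+t\<in>{1..real n}. ennreal (\<rho> t) \<partial>lebesgue) < \<top>"
      using * by (auto simp: trunc_mean_def less_top)
    then have M: "enn2real (trunc_mean \<rho> n) = 1 + I"
      by (simp add: trunc_mean_def I_def enn2real_plus)
    have I: "(\<Sum>j=J..<n. \<rho> (real j) / B) \<le> I"
      unfolding I_def using int[of n] fin enn2real_mono
      by (smt (verit) enn2real_ennreal enn2real_nonneg)
    have "(\<Sum>j<n. z j) \<le> (\<Sum>j<n. (if j < J then 1 else 0) + (if J \<le> j then \<rho> (real j) else 0))"
      using * J1 by (intro sum_mono) auto
    also have "\<dots> = real (card {j \<in> {..<n}. j < J}) + (\<Sum>j | j < n \<and> J \<le> j. \<rho> (real j))"
      by (simp add: sum.distrib flip: sum.inter_filter)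
    also have "{j. j < n \<and> J \<le> j} = {J..<n}" by auto
    also have "real (card {j \<in> {..<n}. j < J}) \<le> real J"
      using card_mono[of "{..<J}" "{j \<in> {..<n}. j < J}"] by auto
    also have "(\<Sum>j=J..<n. \<rho> (real j)) = B * (\<Sum>j=J..<n. \<rho> (real j) / B)"
      using \<open>B > 0\<close> by (simp add: sum_distrib_left)
    also have "\<dots> \<le> B * I" using I \<open>B > 0\<close> by (intro mult_left_mono) auto
    \<comment> \<open>The summand 1 in M(n) absorbs the first \<open>J\<close> terms.\<close>
    also have "real J + B * I \<le> (real J + B) * (1 + I)"
      using \<open>B > 0\<close> by (simp add: algebra_simps I_def)
    finally show "(\<Sum>j<n. z j) \<le> (real J + B) * enn2real (trunc_mean \<rho> n)"
      by (simp add: M)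
  qed
qed

section \<open>Truncated norms of power series\<close>

text \<open>Mass released at time k according to g that survives the remaining n - k steps. For
  differences of the renewal series it is the l^1 distance of two laws of the chain. Stopping at n
  keeps it finite for every series.\<close>

definition wsum :: "(nat \<Rightarrow> real) \<Rightarrow> nat \<Rightarrow> real fps \<Rightarrow> real" where
  "wsum z n g = (\<Sum>k\<le>n. \<bar>fps_nth g k\<bar> * z (n - k))"

definition l1_upto :: "nat \<Rightarrow> real fps \<Rightarrow> real" where
  "l1_upto n g = (\<Sum>k\<le>n. \<bar>fps_nth g k\<bar>)"

text \<open>Once the factor \<open>a\<close> has used i units of time, n - i remain for
  \<open>b\<close>. With \<open>b\<close> = U every inner sum is 1; with constant weight 1 this
  leads to submultiplicativity of the truncated l^1 norm.\<close>

lemma wsum_mult_le: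
  assumes z: "\<And>k. 0 \<le> z k"
  shows "wsum z n (a * b) \<le> (\<Sum>i\<le>n. \<bar>fps_nth a i\<bar> * wsum z (n - i) b)"
proof -
  have "wsum z n (a * b) \<le> (\<Sum>k\<le>n. \<Sum>i\<le>k. \<bar>fps_nth a i\<bar> * (\<bar>fps_nth b (k - i)\<bar> * z (n - k)))"
    unfolding wsum_def
  proof (rule sum_mono)
    fix k
    have "\<bar>fps_nth (a * b) k\<bar> \<le> (\<Sum>i\<le>k. \<bar>fps_nth a i * fps_nth b (k - i)\<bar>)"
      by (simp add: fps_mult_nth atMost_atLeast0 sum_abs)
    then have "\<bar>fps_nth (a * b) k\<bar> * z (n - k)
        \<le> (\<Sum>i\<le>k. \<bar>fps_nth a i * fps_nth b (k - i)\<bar>) * z (n - k)"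
      using z by (intro mult_right_mono)
    then show "\<bar>fps_nth (a * b) k\<bar> * z (n - k)
        \<le> (\<Sum>i\<le>k. \<bar>fps_nth a i\<bar> * (\<bar>fps_nth b (k - i)\<bar> * z (n - k)))"
      by (simp add: sum_distrib_right abs_mult mult.assoc)
  qed
  also have "\<dots> = (\<Sum>k\<le>n. \<Sum>i\<le>k. \<bar>fps_nth a i\<bar> * (\<bar>fps_nth b (k - i)\<bar> * z (n - i - (k - i))))"
    by (intro sum.cong) auto
  also have "\<dots> = (\<Sum>(i, j)\<in>{(i, j). i + j \<le> n}. \<bar>fps_nth a i\<bar> * (\<bar>fps_nth b j\<bar> * z (n - i - j)))"
    by (rule sum.triangle_reindex_eq[symmetric])
  also have "{(i, j). i + j \<le> n} = Sigma {..n} (\<lambda>i. {..n - i})" by auto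
  also have "(\<Sum>(i, j)\<in>Sigma {..n} (\<lambda>i. {..n - i}). \<bar>fps_nth a i\<bar> * (\<bar>fps_nth b j\<bar> * z (n - i - j)))
      = (\<Sum>i\<le>n. \<bar>fps_nth a i\<bar> * wsum z (n - i) b)"
    by (subst sum.Sigma[symmetric]) (auto simp: wsum_def sum_distrib_left)
  finally show ?thesis .
qed

lemma wsum_add_le:
  assumes "\<And>k. 0 \<le> z k"
  shows "wsum z n (a + b) \<le> wsum z n a + wsum z n b"
  unfolding wsum_def sum.distrib[symmetric]
  using assms by (intro sum_mono) (auto simp flip: distrib_right intro!: mult_right_mono)

lemma wsum_minus [simp]: "wsum z n (- a) = wsum z n a"
  by (simp add: wsum_def)

lemma wsum_X_power_mult: "wsum z (n + l) (fps_X ^ l * g) = wsum z n g"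
proof -
  have "wsum z (n + l) (fps_X ^ l * g) = (\<Sum>k\<in>{0 + l..n + l}. \<bar>fps_nth g (k - l)\<bar> * z (n + l - k))"
    unfolding wsum_def by (intro sum.mono_neutral_cong_right) (auto simp: fps_X_power_mult_nth)
  also have "\<dots> = wsum z n g"
    unfolding sum.shift_bounds_cl_nat_ivl by (simp add: wsum_def atMost_atLeast0)
  finally show ?thesis .
qed

lemma l1_upto_eq_wsum: "l1_upto n g = wsum (\<lambda>_. 1) n g"
  by (simp add: l1_upto_def wsum_def)

lemma l1_upto_nonneg [simp]: "0 \<le> l1_upto n g"
  by (simp add: l1_upto_def sum_nonneg)

lemma l1_upto_mono: "n \<le> n' \<Longrightarrow> l1_upto n g \<le> l1_upto n' g"
  unfolding l1_upto_def by (intro sum_mono2) auto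

lemma l1_upto_mult: "l1_upto n (a * b) \<le> l1_upto n a * l1_upto n b"
proof -
  have "l1_upto n (a * b) \<le> (\<Sum>i\<le>n. \<bar>fps_nth a i\<bar> * l1_upto (n - i) b)"
    using wsum_mult_le[of "\<lambda>_. 1" n a b] by (simp add: l1_upto_eq_wsum)
  also have "\<dots> \<le> (\<Sum>i\<le>n. \<bar>fps_nth a i\<bar> * l1_upto n b)"
    by (intro sum_mono mult_left_mono l1_upto_mono) auto
  finally show ?thesis by (simp add: l1_upto_def sum_distrib_right)
qed

lemma l1_upto_mult_le: "l1_upto n a \<le> x \<Longrightarrow> l1_upto n b \<le> y \<Longrightarrow> l1_upto n (a * b) \<le> x * y"
  using l1_upto_mult[of n a b] mult_mono[of "l1_upto n a" x "l1_upto n b" y]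
    l1_upto_nonneg[of n a] l1_upto_nonneg[of n b] by linarith

lemma l1_upto_add: "l1_upto n (a + b) \<le> l1_upto n a + l1_upto n b"
  using wsum_add_le[of "\<lambda>_. 1" n a b] by (simp add: l1_upto_eq_wsum)

lemma l1_upto_minus [simp]: "l1_upto n (- a) = l1_upto n a"
  by (simp add: l1_upto_eq_wsum)

lemma l1_upto_diff: "l1_upto n (a - b) \<le> l1_upto n a + l1_upto n b"
  using l1_upto_add[of n a "- b"] by simp

lemma l1_upto_const_mult [simp]: "l1_upto n (fps_const c * g) = \<bar>c\<bar> * l1_upto n g"
  by (simp add: l1_upto_def abs_mult sum_distrib_left)

lemma l1_upto_X_power: "l1_upto n (fps_X ^ k) \<le> 1"
  by (simp add: l1_upto_def if_distrib sum.delta cong: if_cong)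

lemma l1_upto_1 [simp]: "l1_upto n 1 = 1"
  by (simp add: l1_upto_def if_distrib sum.delta cong: if_cong)

lemma l1_upto_0 [simp]: "l1_upto n 0 = 0"
  by (simp add: l1_upto_def)

lemma l1_upto_sum: "l1_upto n (\<Sum>i\<in>I. g i) \<le> (\<Sum>i\<in>I. l1_upto n (g i))"
proof (induction I rule: infinite_finite_induct)
  case (insert i I)
  then show ?case using l1_upto_add[of n "g i" "sum g I"] by simp
qed simp_all

lemma l1_upto_power: "l1_upto n g \<le> x \<Longrightarrow> l1_upto n (g ^ m) \<le> x ^ m"
  by (induction m) (auto intro: l1_upto_mult_le)

lemma l1_upto_power_diff:
  assumes "l1_upto n a \<le> 1" "l1_upto n b \<le> 1"
  shows "l1_upto n (a ^ m - b ^ m) \<le> real m * l1_upto n (a - b)"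
proof (induction m)
  case (Suc m)
  have "a ^ Suc m - b ^ Suc m = (a - b) * a ^ m + b * (a ^ m - b ^ m)"
    by (simp add: algebra_simps)
  then have "l1_upto n (a ^ Suc m - b ^ Suc m)
      \<le> l1_upto n ((a - b) * a ^ m) + l1_upto n (b * (a ^ m - b ^ m))"
    using l1_upto_add by metis
  also have "l1_upto n ((a - b) * a ^ m) \<le> l1_upto n (a - b) * 1 ^ m"
    using assms by (intro l1_upto_mult_le l1_upto_power) auto
  also have "l1_upto n (b * (a ^ m - b ^ m)) \<le> 1 * (real m * l1_upto n (a - b))"
    using assms Suc by (intro l1_upto_mult_le) auto
  finally show ?case by (simp add: algebra_simps)
qed simp

section \<open>Smoothing by convolution powers\<close>

text \<open>Up to the factor 2^n this is the variance of a sum of n fair signs. The square is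
  expanded in 1, i and i (i - 1), whose sums against Bernstein polynomials are known.\<close>

lemma binomial_second_moment:
  "(\<Sum>i\<le>n. real (n choose i) * (real n - 2 * real i)\<^sup>2) = real n * 2 ^ n"
proof -
  have B: "Bernstein n i (1/2) = real (n choose i) / 2 ^ n" if "i \<le> n" for i
    using that by (simp add: Bernstein_def power_one_over field_simps flip: power_add)
  have "(\<Sum>i\<le>n. real (n choose i) * (real n - 2 * real i)\<^sup>2) / 2 ^ n
      = (\<Sum>i\<le>n. (real n)\<^sup>2 * Bernstein n i (1/2) + (4 - 4 * real n) * (real i * Bernstein n i (1/2))
          + 4 * (real i * (real i - 1) * Bernstein n i (1/2)))"
    unfolding sum_divide_distrib
    by (intro sum.cong) (auto simp: B power2_eq_square field_simps)
  also have "\<dots> = (real n)\<^sup>2 + (4 - 4 * real n) * (real n * (1/2)) + 4 * (real n * (real n - 1) * (1/2)\<^sup>2)"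
    by (simp only: sum.distrib sum_distrib_left[symmetric] sum_Bernstein sum_k_Bernstein sum_kk_Bernstein mult_1_right)
  also have "\<dots> = real n" by (simp add: power2_eq_square algebra_simps)
  finally show ?thesis by (simp add: field_simps)
qed

text \<open>The coefficients C(j, i) - C(j, i - 1) of (1 - y) (1 + y)^j equal C(j + 1, i) (j + 1 - 2
  i) / (j + 1), with the displacement of a walk of j + 1 signs. Multiplying by j + 1 avoids division
  in the ring.\<close>

lemma one_minus_mult_one_plus_power:
  fixes y :: "'a::comm_ring_1"
  shows "of_nat (Suc j) * ((1 - y) * (1 + y) ^ j)
    = (\<Sum>i\<le>Suc j. of_int (int (Suc j choose i) * (int (Suc j) - 2 * int i)) * y ^ i)"
proof -
  have 1: "(1 + y) ^ k = (\<Sum>i\<le>k. of_nat (k choose i) * y ^ i)" for k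
    using binomial_ring[of y 1 k] by (simp add: add.commute)
  have "(\<Sum>i\<le>Suc j. of_nat (i * (Suc j choose i)) * y ^ i)
      = (\<Sum>i\<le>j. of_nat (Suc i * (Suc j choose Suc i)) * y ^ Suc i)"
    by (subst sum.atMost_Suc_shift) simp
  also have "\<dots> = of_nat (Suc j) * y * (\<Sum>i\<le>j. of_nat (j choose i) * y ^ i)"
    unfolding binomial_absorption diff_Suc_1 sum_distrib_left
    by (intro sum.cong) (auto simp: algebra_simps)
  finally have 2: "(\<Sum>i\<le>Suc j. of_nat (i * (Suc j choose i)) * y ^ i) = of_nat (Suc j) * y * (1 + y) ^ j"
    by (simp only: 1)
  have "of_nat (Suc j) * ((1 - y) * (1 + y) ^ j)
      = of_nat (Suc j) * (1 + y) ^ Suc j - 2 * (of_nat (Suc j) * y * (1 + y) ^ j)"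
    by (simp add: algebra_simps)
  also have "\<dots> = (\<Sum>i\<le>Suc j. of_nat (Suc j) * (of_nat (Suc j choose i) * y ^ i)
        - 2 * (of_nat (i * (Suc j choose i)) * y ^ i))"
    by (simp only: 2[symmetric] 1[of "Suc j"] sum_distrib_left sum_subtractf)
  also have "\<dots> = (\<Sum>i\<le>Suc j. of_int (int (Suc j choose i) * (int (Suc j) - 2 * int i)) * y ^ i)"
    by (intro sum.cong) (auto simp: algebra_simps)
  finally show ?thesis .
qed

text \<open>After division by 2^j the norm is at most 2 / (j + 1) times the mean absolute value of a
  sum of j + 1 signs, and |t| \<le> (t^2 / s + s) / 2. The parameter \<open>s\<close> stays free
  because j will be random while one \<open>s\<close> must serve all j.\<close>

lemma l1_upto_one_minus_mult_one_plus_power: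
  fixes s :: real
  assumes "s > 0" and y: "\<And>i. l1_upto n (y ^ i) \<le> 1"
  shows "l1_upto n ((1 - y) * (1 + y) ^ j) \<le> 2 ^ j * (1 / s + s / real (j + 1))"
proof -
  let ?c = "\<lambda>i. real (Suc j choose i) * (real (Suc j) - 2 * real i)"
  have "real (Suc j) * l1_upto n ((1 - y) * (1 + y) ^ j)
      = l1_upto n (of_nat (Suc j) * ((1 - y) * (1 + y) ^ j))"
    by (simp only: fps_of_nat[symmetric] l1_upto_const_mult abs_of_nat)
  also have "\<dots> = l1_upto n (\<Sum>i\<le>Suc j. fps_const (?c i) * y ^ i)"
    unfolding one_minus_mult_one_plus_power by (simp flip: fps_of_int)
  also have "\<dots> \<le> (\<Sum>i\<le>Suc j. \<bar>?c i\<bar> * 1)"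
    by (intro order_trans[OF l1_upto_sum] sum_mono)
       (simp only: l1_upto_const_mult, intro mult_left_mono y abs_ge_zero)
  also have "\<dots> \<le> (\<Sum>i\<le>Suc j. (real (Suc j choose i) * (real (Suc j) - 2 * real i)\<^sup>2 / s + s * real (Suc j choose i)) / 2)"
  proof (rule sum_mono)
    fix i
    let ?t = "\<bar>real (Suc j) - 2 * real i\<bar>"
    have "0 \<le> (?t - s)\<^sup>2 / s" using \<open>s > 0\<close> by simp
    also have "\<dots> = ?t\<^sup>2 / s - 2 * ?t + s" using \<open>s > 0\<close> by (simp add: power2_eq_square field_simps)
    finally have "?t \<le> (?t\<^sup>2 / s + s) / 2" by simp
    then have "real (Suc j choose i) * ?t \<le> real (Suc j choose i) * ((?t\<^sup>2 / s + s) / 2)"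
      by (intro mult_left_mono) auto
    then show "\<bar>?c i\<bar> * 1 \<le> (real (Suc j choose i) * (real (Suc j) - 2 * real i)\<^sup>2 / s + s * real (Suc j choose i)) / 2"
      by (simp only: abs_mult abs_of_nat power2_abs) (simp add: field_simps)
  qed
  also have "\<dots> = (real (Suc j) * 2 ^ Suc j / s + s * 2 ^ Suc j) / 2"
  proof -
    have "(\<Sum>i\<le>Suc j. real (Suc j choose i)) = 2 ^ Suc j"
      using choose_row_sum[of "Suc j"] by (metis of_nat_numeral of_nat_power of_nat_sum)
    then show ?thesis
      unfolding sum_divide_distrib[symmetric] sum.distrib sum_distrib_left[symmetric] binomial_second_moment
      by simp
  qed
  also have "\<dots> = real (Suc j) * (2 ^ j * (1 / s + s / real (j + 1)))"
    by (simp add: field_simps)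
  finally show ?thesis by (rule mult_left_le_imp_le) simp
qed

text \<open>The mean of 1 / (J + 1) for a binomial J: since C(m, j) / (j + 1) = C(m + 1, j + 1) / (m
  + 1), the sum becomes a binomial probability for m + 1 trials, short of the term at 0.\<close>

lemma sum_Bernstein_div_Suc:
  fixes b :: real
  assumes "0 < b" "b \<le> 1"
  shows "(\<Sum>j\<le>m. Bernstein m j b / real (j + 1)) \<le> 1 / (b * real (m + 1))"
proof -
  have "Bernstein m j b / real (j + 1) = Bernstein (Suc m) (Suc j) b / (b * real (m + 1))" for j
  proof -
    have "real (Suc j) * real (Suc m choose Suc j) = real (Suc m) * real (m choose j)"
      using binomial_absorption[of j "Suc m"] by (simp only: diff_Suc_1 flip: of_nat_mult)
    then show ?thesis using assms
      by (simp add: Bernstein_def field_simps del: of_nat_Suc binomial_Suc_Suc)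
  qed
  then have "(\<Sum>j\<le>m. Bernstein m j b / real (j + 1))
      = (\<Sum>j\<le>m. Bernstein (Suc m) (Suc j) b) / (b * real (m + 1))"
    by (simp add: sum_divide_distrib)
  also have "(\<Sum>j\<le>m. Bernstein (Suc m) (Suc j) b) \<le> (\<Sum>j\<le>Suc m. Bernstein (Suc m) j b)"
    using assms by (subst sum.atMost_Suc_shift) (simp add: Bernstein_nonneg)
  finally show ?thesis using assms by (simp add: divide_right_mono)
qed

text \<open>Expanding the power amounts to conditioning on the number j of factors, binomial with
  parameter 2 a, that choose the part a (1 + y). Those factors smooth; the factors \<open>r\<close>
  contribute only their mass.\<close>

lemma l1_upto_one_minus_mult_power:
  fixes a :: real
  assumes "0 < a" "2 * a \<le> 1" and r: "l1_upto n r \<le> 1 - 2 * a"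
    and y: "\<And>i. l1_upto n (y ^ i) \<le> 1"
  shows "l1_upto n ((1 - y) * (fps_const a * (1 + y) + r) ^ m) \<le> 2 / sqrt (2 * a * real (m + 1))"
proof -
  \<comment> \<open>This value makes 1 / s equal to s / (2 a (m + 1)), the bound for the averaged
    second term.\<close>
  define s where "s = sqrt (2 * a * real (m + 1))"
  have "s > 0" using assms by (simp add: s_def)
  let ?B = "\<lambda>j. Bernstein m j (2 * a)"
  have const: "fps_const (real (m choose j) * a ^ j) = of_nat (m choose j) * fps_const a ^ j" for j
    by (simp add: fps_of_nat flip: fps_const_mult)
  have "(1 - y) * (fps_const a * (1 + y) + r) ^ m
      = (\<Sum>j\<le>m. (1 - y) * (of_nat (m choose j) * (fps_const a * (1 + y)) ^ j * r ^ (m - j)))"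
    by (subst binomial_ring) (rule sum_distrib_left)
  also have "\<dots> = (\<Sum>j\<le>m. fps_const (real (m choose j) * a ^ j) * (((1 - y) * (1 + y) ^ j) * r ^ (m - j)))"
    by (intro sum.cong refl) (simp only: const power_mult_distrib, simp only: mult_ac)
  finally have "l1_upto n ((1 - y) * (fps_const a * (1 + y) + r) ^ m)
      = l1_upto n (\<Sum>j\<le>m. fps_const (real (m choose j) * a ^ j) * (((1 - y) * (1 + y) ^ j) * r ^ (m - j)))"
    by (rule arg_cong)
  also have "\<dots> \<le> (\<Sum>j\<le>m. l1_upto n (fps_const (real (m choose j) * a ^ j) * (((1 - y) * (1 + y) ^ j) * r ^ (m - j))))"
    by (rule l1_upto_sum)
  also have "\<dots> \<le> (\<Sum>j\<le>m. ?B j * (1 / s + s / real (j + 1)))"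
  proof (rule sum_mono)
    fix j
    have "l1_upto n (((1 - y) * (1 + y) ^ j) * r ^ (m - j))
        \<le> (2 ^ j * (1 / s + s / real (j + 1))) * (1 - 2 * a) ^ (m - j)"
      by (intro l1_upto_mult_le l1_upto_power r l1_upto_one_minus_mult_one_plus_power y \<open>s > 0\<close>)
    then have "real (m choose j) * a ^ j * l1_upto n (((1 - y) * (1 + y) ^ j) * r ^ (m - j))
        \<le> real (m choose j) * a ^ j * ((2 ^ j * (1 / s + s / real (j + 1))) * (1 - 2 * a) ^ (m - j))"
      using assms by (intro mult_left_mono) auto
    then show "l1_upto n (fps_const (real (m choose j) * a ^ j) * (((1 - y) * (1 + y) ^ j) * r ^ (m - j)))
        \<le> ?B j * (1 / s + s / real (j + 1))"
      unfolding l1_upto_const_mult using assms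
      by (simp add: Bernstein_def power_mult_distrib abs_mult mult_ac)
  qed
  also have "\<dots> = (\<Sum>j\<le>m. ?B j) * (1 / s) + s * (\<Sum>j\<le>m. ?B j / real (j + 1))"
    unfolding distrib_left sum.distrib sum_distrib_right by (simp add: sum_distrib_left mult_ac)
  also have "\<dots> = 1 / s + s * (\<Sum>j\<le>m. ?B j / real (j + 1))" by simp
  also have "\<dots> \<le> 1 / s + s * (1 / (2 * a * real (m + 1)))"
    using sum_Bernstein_div_Suc[of "2 * a" m] \<open>s > 0\<close> assms by (intro add_mono mult_left_mono) auto
  also have "2 * a * real (m + 1) = s * s" using assms by (simp add: s_def)
  also have "1 / s + s * (1 / (s * s)) = 2 / s" using \<open>s > 0\<close> by (simp add: field_simps)
  finally show ?thesis by (simp add: s_def)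
qed

section \<open>From shifts by the atoms to shifts by their gcd\<close>

definition shift_bound :: "real fps \<Rightarrow> real \<Rightarrow> nat \<Rightarrow> bool" where
  "shift_bound g B h \<longleftrightarrow> (\<forall>n. l1_upto n ((1 - fps_X ^ h) * g) \<le> B)"

lemma l1_upto_X_power_mult: "l1_upto (n + h) (fps_X ^ h * g) = l1_upto n g"
  by (simp add: l1_upto_eq_wsum wsum_X_power_mult)

lemma shift_bound_mult:
  assumes "shift_bound g B h"
  shows "shift_bound g (real x * B) (h * x)"
proof (induction x)
  case (Suc x)
  have "l1_upto n ((1 - fps_X ^ (h * Suc x)) * g) \<le> real (Suc x) * B" for n
  proof -
    have "(1 - fps_X ^ (h * Suc x)) * g
        = (1 - fps_X ^ (h * x)) * g + fps_X ^ (h * x) * ((1 - fps_X ^ h) * g)"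
      by (simp add: algebra_simps power_add)
    then have "l1_upto n ((1 - fps_X ^ (h * Suc x)) * g)
        \<le> l1_upto n ((1 - fps_X ^ (h * x)) * g) + l1_upto n (fps_X ^ (h * x) * ((1 - fps_X ^ h) * g))"
      using l1_upto_add by metis
    also have "l1_upto n (fps_X ^ (h * x) * ((1 - fps_X ^ h) * g)) \<le> 1 * B"
      using assms by (intro l1_upto_mult_le l1_upto_X_power) (auto simp: shift_bound_def)
    also have "l1_upto n ((1 - fps_X ^ (h * x)) * g) \<le> real x * B"
      using Suc by (auto simp: shift_bound_def)
    finally show ?thesis by (simp add: algebra_simps)
  qed
  then show ?case by (simp add: shift_bound_def)
qed (simp add: shift_bound_def)

text \<open>Multiplication by X^h moves the cut-off from n to n + h without changing the norm, so
  X^h can be cancelled. This is why \<open>shift_bound\<close> quantifies over all cut-offs.\<close>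

lemma shift_bound_diff:
  assumes "shift_bound g B (h + d)" "shift_bound g B' h"
  shows "shift_bound g (B + B') d"
  unfolding shift_bound_def
proof
  fix n
  have "l1_upto n ((1 - fps_X ^ d) * g) = l1_upto (n + h) (fps_X ^ h * ((1 - fps_X ^ d) * g))"
    by (simp add: l1_upto_X_power_mult)
  also have "fps_X ^ h * ((1 - fps_X ^ d) * g) = (1 - fps_X ^ (h + d)) * g - (1 - fps_X ^ h) * g"
    by (simp add: algebra_simps power_add)
  also have "l1_upto (n + h) \<dots> \<le> B + B'"
    using assms by (intro order_trans[OF l1_upto_diff] add_mono) (auto simp: shift_bound_def)
  finally show "l1_upto n ((1 - fps_X ^ d) * g) \<le> B + B'" .
qed

text \<open>Induction over \<open>A\<close> with Bezout's identity in the form a x = Gcd(A) y +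
  gcd(a, Gcd(A)). The constant comes from the Bezout coefficients, hence depends on \<open>A\<close>
  only.\<close>

lemma shift_bound_Gcd:
  assumes "finite A"
  shows "\<exists>C\<ge>0. \<forall>g B. B \<ge> 0 \<and> (\<forall>h\<in>A. shift_bound g B h) \<longrightarrow> shift_bound g (C * B) (Gcd A)"
  using assms
proof (induction A)
  case empty
  then show ?case by (intro exI[of _ 0]) (auto simp: shift_bound_def)
next
  case (insert a A)
  then obtain C where "C \<ge> 0" and C: "\<And>g B. B \<ge> 0 \<Longrightarrow> (\<forall>h\<in>A. shift_bound g B h) \<Longrightarrow> shift_bound g (C * B) (Gcd A)"
    by blast
  show ?case
  proof (cases "a = 0")
    case True
    then show ?thesis using C \<open>C \<ge> 0\<close> by (intro exI[of _ C]) auto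
  next
    case False
    then obtain x y where xy: "a * x = Gcd A * y + gcd a (Gcd A)" using bezout_nat by blast
    show ?thesis
    proof (intro exI[of _ "real x + real y * C"] conjI allI impI)
      fix g B assume B: "B \<ge> 0 \<and> (\<forall>h\<in>insert a A. shift_bound g B h)"
      then have "shift_bound g (real x * B) (a * x)" "shift_bound g (real y * (C * B)) (Gcd A * y)"
        using C by (auto intro: shift_bound_mult)
      then have "shift_bound g (real x * B + real y * (C * B)) (gcd a (Gcd A))"
        unfolding xy by (rule shift_bound_diff)
      then show "shift_bound g ((real x + real y * C) * B) (Gcd (insert a A))"
        by (simp add: algebra_simps)
    qed (use \<open>C \<ge> 0\<close> in auto)
  qed
qed

text \<open>Laziness pairs every atom k of f with the atom at 0, so (1 + f) / 2 contains (c / 2) (1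
  + X^k) and shifts by k are smoothed. Bezout's identity reaches the gcd 1, and l unit shifts give
  the factor l.\<close>

lemma lazy_power_smoothing:
  fixes c :: real and N :: nat
  assumes "c > 0"
  shows "\<exists>C\<ge>0. \<forall>f m l n. (\<forall>k. fps_nth f k \<ge> 0) \<and> (\<forall>n. l1_upto n f \<le> 1) \<and>
            Gcd {k. 1 \<le> k \<and> k \<le> N \<and> fps_nth f k \<ge> c} = 1 \<longrightarrow>
            l1_upto n ((1 - fps_X ^ l) * (fps_const (1/2) * (1 + f)) ^ m) \<le> C * real l / sqrt (real (m + 1))"
proof -
  have "\<forall>A\<in>Pow {..N}. \<exists>C\<ge>0. \<forall>g B. B \<ge> 0 \<and> (\<forall>h\<in>A. shift_bound g B h) \<longrightarrow> shift_bound g (C * B) (Gcd A)"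
    using shift_bound_Gcd by (meson PowD finite_atMost finite_subset)
  then obtain K where K0: "\<And>A. A \<subseteq> {..N} \<Longrightarrow> K A \<ge> 0" and
    K: "\<And>A g B. A \<subseteq> {..N} \<Longrightarrow> B \<ge> 0 \<Longrightarrow> (\<forall>h\<in>A. shift_bound g B h) \<Longrightarrow> shift_bound g (K A * B) (Gcd A)"
    by (metis PowI)
  \<comment> \<open>Only finitely many sets of atoms lie in \<open>{..N}\<close>; summing their
    constants gives one that is independent of f.\<close>
  define C where "C = (\<Sum>A\<in>Pow {..N}. K A)"
  have KC: "K A \<le> C" if "A \<subseteq> {..N}" for A
    unfolding C_def using that K0 by (intro member_le_sum) auto
  have C0: "C \<ge> 0" unfolding C_def using K0 by (intro sum_nonneg) auto
  show ?thesis
  proof (intro exI[of _ "C * (2 / sqrt c)"] conjI allI impI)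
    fix f :: "real fps" and m l n
    assume *: "(\<forall>k. fps_nth f k \<ge> 0) \<and> (\<forall>n. l1_upto n f \<le> 1) \<and>
      Gcd {k. 1 \<le> k \<and> k \<le> N \<and> fps_nth f k \<ge> c} = 1"
    define A where "A = {k. 1 \<le> k \<and> k \<le> N \<and> fps_nth f k \<ge> c}"
    define g where "g = (fps_const (1/2) * (1 + f)) ^ m"
    define B where "B = 2 / sqrt (c * real (m + 1))"
    have "shift_bound g B k" if "k \<in> A" for k
      unfolding shift_bound_def
    proof
      fix n
      define r where "r = fps_const ((1 - c) / 2) + fps_const (1/2) * (f - fps_const c * fps_X ^ k)"
      have fk: "fps_nth f k \<ge> c" using that by (simp add: A_def)
      have "fps_nth f k \<le> l1_upto k f"
        unfolding l1_upto_def by (rule order_trans[OF _ member_le_sum[of k]]) auto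
      also have "\<dots> \<le> 1" using * by auto
      finally have "c \<le> 1" using fk by simp
      \<comment> \<open>With the cut-off raised to n + k, the reduced atom lies in the range and the
        norm drops by exactly \<open>c\<close>.\<close>
      have "l1_upto n (f - fps_const c * fps_X ^ k) \<le> l1_upto (n + k) (f - fps_const c * fps_X ^ k)"
        by (intro l1_upto_mono) simp
      also have "\<dots> = (\<Sum>i\<le>n + k. fps_nth f i - (if i = k then c else 0))"
        unfolding l1_upto_def using * fk by (intro sum.cong) auto
      also have "\<dots> = l1_upto (n + k) f - c"
        using * by (simp add: sum_subtractf l1_upto_def sum.delta)
      also have "\<dots> \<le> 1 - c" using * by simp
      finally have "l1_upto n (f - fps_const c * fps_X ^ k) \<le> 1 - c" .
      moreover have "l1_upto n (fps_const ((1 - c) / 2)) = (1 - c) / 2"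
        using l1_upto_const_mult[of n "(1 - c) / 2" 1] \<open>c \<le> 1\<close> by simp
      ultimately have r: "l1_upto n r \<le> 1 - 2 * (c / 2)"
        using l1_upto_add[of n "fps_const ((1 - c) / 2)" "fps_const (1/2) * (f - fps_const c * fps_X ^ k)"]
        unfolding r_def l1_upto_const_mult by simp
      have e: "fps_const (1/2) * (1 + f) = fps_const (c / 2) * (1 + fps_X ^ k) + r"
        by (rule fps_ext) (auto simp: r_def algebra_simps diff_divide_distrib add_divide_distrib)
      have "l1_upto n ((1 - fps_X ^ k) * (fps_const (c / 2) * (1 + fps_X ^ k) + r) ^ m)
          \<le> 2 / sqrt (2 * (c / 2) * real (m + 1))"
        by (intro l1_upto_one_minus_mult_power r)
           (use \<open>c > 0\<close> \<open>c \<le> 1\<close> l1_upto_X_power in \<open>auto simp flip: power_mult\<close>)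
      then show "l1_upto n ((1 - fps_X ^ k) * g) \<le> B"
        by (simp add: g_def e B_def)
    qed
    moreover have "A \<subseteq> {..N}" by (auto simp: A_def)
    moreover have "B \<ge> 0" using \<open>c > 0\<close> by (simp add: B_def)
    ultimately have "shift_bound g (K A * B) (Gcd A)" by (intro K) auto
    then have "shift_bound g (real l * (K A * B)) (1 * l)"
      using * by (intro shift_bound_mult) (simp add: A_def)
    then have "l1_upto n ((1 - fps_X ^ l) * g) \<le> real l * (K A * B)"
      by (simp add: shift_bound_def)
    also have "\<dots> \<le> real l * (C * B)"
      using KC[OF \<open>A \<subseteq> {..N}\<close>] \<open>B \<ge> 0\<close> by (intro mult_left_mono mult_right_mono) auto
    also have "\<dots> = C * (2 / sqrt c) * real l / sqrt (real (m + 1))"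
      by (simp add: B_def real_sqrt_mult)
    finally show "l1_upto n ((1 - fps_X ^ l) * (fps_const (1/2) * (1 + f)) ^ m)
        \<le> C * (2 / sqrt c) * real l / sqrt (real (m + 1))"
      by (simp add: g_def)
  qed (use C0 \<open>c > 0\<close> in auto)
qed


section \<open>The renewal equation\<close>

lemma fps_mult_nth_nonneg:
  fixes a b :: "real fps"
  assumes "\<And>k. 0 \<le> fps_nth a k" "\<And>k. 0 \<le> fps_nth b k"
  shows "0 \<le> fps_nth (a * b) n"
  using assms by (auto simp: fps_mult_nth intro!: sum_nonneg)

lemma fps_power_nth_nonneg:
  fixes a :: "real fps"
  assumes "\<And>k. 0 \<le> fps_nth a k"
  shows "0 \<le> fps_nth (a ^ m) n"
  by (induction m arbitrary: n) (auto intro: fps_mult_nth_nonneg assms)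

lemma fps_inverse_one_minus_nth_nonneg:
  fixes f :: "real fps"
  assumes "\<And>k. 0 \<le> fps_nth f k" "fps_nth f 0 = 0"
  shows "0 \<le> fps_nth (inverse (1 - f)) n"
proof (induction n rule: less_induct)
  case (less n)
  let ?U = "inverse (1 - f)"
  have "(1 - f) * ?U = 1" using assms by (intro inverse_mult_eq_1') simp
  then have "?U = 1 + f * ?U" by (simp add: algebra_simps)
  then have "fps_nth ?U n = fps_nth 1 n + fps_nth (f * ?U) n" by (metis fps_add_nth)
  moreover have "fps_nth (f * ?U) n = (\<Sum>i=1..n. fps_nth f i * fps_nth ?U (n - i))"
    unfolding fps_mult_nth using assms(2)
    by (intro sum.mono_neutral_right) (auto simp: Suc_le_eq)
  moreover have "\<dots> \<ge> 0" using less assms by (intro sum_nonneg mult_nonneg_nonneg) auto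
  ultimately show ?case by simp
qed

text \<open>Here \<open>f_0\<close> makes 1 - f invertible, and \<open>z_eq\<close> with
  \<open>z_nonneg\<close> bounds all partial sums of \<open>f\<close> by 1, so infinite sums never
  appear.\<close>

locale renewal =
  fixes f :: "real fps" and z :: "nat \<Rightarrow> real"
  assumes f_nonneg: "0 \<le> fps_nth f k" and f_0: "fps_nth f 0 = 0"
    and z_nonneg: "0 \<le> z k" and z_eq: "z n = 1 - (\<Sum>k\<le>n. fps_nth f k)"
begin

definition U :: "real fps" where "U = inverse (1 - f)"

definition lazy :: "real fps" where "lazy = fps_const (1/2) * (1 + f)"

lemma U_nonneg: "0 \<le> fps_nth U n"
  unfolding U_def by (intro fps_inverse_one_minus_nth_nonneg f_nonneg f_0)

lemma U_eq: "(1 - f) * U = 1"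
  unfolding U_def by (intro inverse_mult_eq_1') (simp add: f_0)

lemma f_le_1: "l1_upto n f \<le> 1"
  using z_nonneg[of n] z_eq[of n] f_nonneg by (simp add: l1_upto_def)

lemma lazy_nonneg: "0 \<le> fps_nth lazy k"
  using f_nonneg by (simp add: lazy_def)

lemma lazy_power_le_1: "l1_upto n (lazy ^ m) \<le> 1"
proof -
  have "l1_upto n lazy \<le> 1"
    using l1_upto_add[of n 1 f] f_le_1[of n] unfolding lazy_def l1_upto_const_mult by simp
  then show ?thesis using l1_upto_power[of n lazy 1 m] by simp
qed

lemma tail_fps: "Abs_fps z * (1 - fps_X) = 1 - f"
proof (rule fps_ext)
  fix n
  show "fps_nth (Abs_fps z * (1 - fps_X)) n = fps_nth (1 - f) n"
    by (cases n) (simp_all add: algebra_simps z_eq f_0)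
qed

text \<open>Summation by parts gives z (1 - X) = 1 - f, which U cancels. All coefficients of 1 / (1
  - X) are 1: the chain has total mass 1 at each time.\<close>

lemma tail_fps_U: "Abs_fps z * U = inverse (1 - fps_X)"
proof -
  have "(1 - fps_X) * (Abs_fps z * U) = (Abs_fps z * (1 - fps_X)) * U"
    by (simp only: mult_ac)
  then have "(1 - fps_X) * (Abs_fps z * U) = 1" by (simp only: tail_fps U_eq)
  then show ?thesis by (intro fps_inverse_unique[symmetric])
qed

lemma wsum_eq_mult_nth:
  assumes "\<And>k. 0 \<le> fps_nth g k"
  shows "wsum z n g = fps_nth (Abs_fps z * g) n"
  using assms by (simp add: wsum_def mult.commute[of "Abs_fps z"] fps_mult_nth atMost_atLeast0)

lemma inverse_one_minus_X: "inverse (1 - fps_X) = Abs_fps (\<lambda>_. 1 :: real)"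
  by (metis fps_inverse_gp' fps_inverse_idempotent fps_nth_Abs_fps zero_neq_one)

lemma inverse_one_minus_X_mult_nth:
  "fps_nth (inverse (1 - fps_X) * g) n = (\<Sum>k\<le>n. fps_nth (g :: real fps) k)"
  by (simp add: inverse_one_minus_X mult.commute[of _ g] fps_mult_nth atMost_atLeast0)

lemma wsum_U: "wsum z n U = 1"
  by (simp add: wsum_eq_mult_nth U_nonneg tail_fps_U inverse_one_minus_X)

text \<open>
  Split \<open>U = (1 - V) U + V U\<close> with \<open>V = lazy ^ m\<close>, the law of a sum of \<open>m\<close> lazy steps. The first
  part has nonnegative coefficients and \<open>z\<close>-mass at time \<open>n\<close> equal to the probability that the sum
  exceeds \<open>n\<close>; the second one is smoothed by \<open>V\<close>.
\<close>

lemma wsum_shift_diff_U_le: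
  "wsum z (n + l) ((1 - fps_X ^ l) * U)
     \<le> 2 * (1 - l1_upto n (lazy ^ m)) + l1_upto (n + l) ((1 - fps_X ^ l) * lazy ^ m)"
proof -
  define V where "V = lazy ^ m"
  \<comment> \<open>Since 1 - lazy = (1 - f) / 2, this is (1 - V) U written as a finite geometric
    sum, which shows that its coefficients are nonnegative.\<close>
  define Y where "Y = fps_const (1/2) * (\<Sum>i<m. lazy ^ i)"
  have "1 - lazy = fps_const (1/2) * (1 - f)"
    by (rule fps_ext) (auto simp: lazy_def algebra_simps)
  then have "1 - V = (1 - f) * Y"
    unfolding V_def Y_def one_diff_power_eq by (simp add: mult_ac)
  then have Y: "Y = (1 - V) * U" using U_eq by (metis mult.assoc mult.commute mult_1_right)
  have Y_nonneg: "0 \<le> fps_nth Y k" for k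
    unfolding Y_def by (auto simp: fps_sum_nth intro!: sum_nonneg fps_power_nth_nonneg lazy_nonneg)
  have V_nonneg: "0 \<le> fps_nth V k" for k
    unfolding V_def by (intro fps_power_nth_nonneg lazy_nonneg)
  have wY: "wsum z k Y = 1 - l1_upto k V" for k
  proof -
    have "Abs_fps z * Y = inverse (1 - fps_X) * (1 - V)"
      unfolding Y tail_fps_U[symmetric] by (simp add: mult_ac)
    then have "wsum z k Y = (\<Sum>i\<le>k. fps_nth (1 - V) i)"
      by (simp only: wsum_eq_mult_nth[OF Y_nonneg] inverse_one_minus_X_mult_nth)
    then show ?thesis using V_nonneg by (simp add: sum_subtractf l1_upto_def)
  qed
  \<comment> \<open>The factor X^l turns time n + l back into time n. Both copies of
    \<open>Y\<close> then weigh at most 1 - \<open>l1_upto n V\<close>, whence the factor 2.\<close>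
  have "(1 - fps_X ^ l) * U = (Y + - (fps_X ^ l * Y)) + ((1 - fps_X ^ l) * V) * U"
    unfolding Y by (simp add: algebra_simps)
  then have "wsum z (n + l) ((1 - fps_X ^ l) * U)
      \<le> (wsum z (n + l) Y + wsum z (n + l) (- (fps_X ^ l * Y)))
        + wsum z (n + l) (((1 - fps_X ^ l) * V) * U)"
    by (simp only:) (intro order_trans[OF wsum_add_le] add_mono order_refl z_nonneg)
  also have "wsum z (n + l) (- (fps_X ^ l * Y)) = 1 - l1_upto n V"
    by (simp add: wsum_X_power_mult wY)
  also have "wsum z (n + l) Y \<le> 1 - l1_upto n V"
    using l1_upto_mono[of n "n + l" V] by (simp add: wY)
  also have "wsum z (n + l) (((1 - fps_X ^ l) * V) * U) \<le> l1_upto (n + l) ((1 - fps_X ^ l) * V)"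
    using wsum_mult_le[of z "n + l" "(1 - fps_X ^ l) * V" U, OF z_nonneg]
    by (simp add: wsum_U l1_upto_def)
  finally show ?thesis by (simp add: V_def)
qed

text \<open>If T has law f, both sides are the mean of min(T, n); the next identity gives the mean
  of its square.\<close>

lemma first_moment: "(\<Sum>k\<le>n. real k * fps_nth f k) + real n * z n = (\<Sum>j<n. z j)"
proof (induction n)
  case (Suc n)
  have "z n = z (Suc n) + fps_nth f (Suc n)" by (simp add: z_eq)
  with Suc show ?case by (simp add: algebra_simps)
qed simp

lemma second_moment:
  "(\<Sum>k\<le>n. (real k)\<^sup>2 * fps_nth f k) + (real n)\<^sup>2 * z n = (\<Sum>j<n. real (2 * j + 1) * z j)"
proof (induction n)
  case (Suc n)
  have "z n = z (Suc n) + fps_nth f (Suc n)" by (simp add: z_eq)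
  with Suc show ?case by (simp add: algebra_simps power2_eq_square)
qed simp

end

section \<open>Moments of generating polynomials and Chebyshev's inequality\<close>

lemma poly_1_eq_sum:
  fixes p :: "'a::comm_semiring_1 poly"
  assumes "degree p \<le> N"
  shows "poly p 1 = (\<Sum>k\<le>N. coeff p k)"
  by (subst poly_as_sum_of_monoms'[OF assms, symmetric]) (simp add: poly_sum poly_monom)

text \<open>These are the factorial moments of a generating polynomial. A free \<open>N\<close> lets
  the sums run past the degree, up to the threshold in Chebyshev's inequality.\<close>

lemma poly_pderiv_1_eq_sum:
  fixes p :: "real poly"
  assumes "degree p \<le> N"
  shows "poly (pderiv p) 1 = (\<Sum>k\<le>N. real k * coeff p k)"
    and "poly (pderiv (pderiv p)) 1 = (\<Sum>k\<le>N. real k * (real k - 1) * coeff p k)"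
proof -
  note pderiv_sum = higher_pderiv_sum[of 1, simplified]
  have 1: "pderiv p = (\<Sum>k\<le>N. monom (real k * coeff p k) (k - 1))"
    by (subst poly_as_sum_of_monoms'[OF assms, symmetric])
       (simp add: pderiv_sum pderiv_monom)
  then show "poly (pderiv p) 1 = (\<Sum>k\<le>N. real k * coeff p k)"
    by (simp add: poly_sum poly_monom)
  have "poly (pderiv (pderiv p)) 1 = (\<Sum>k\<le>N. real (k - 1) * (real k * coeff p k))"
    unfolding 1 by (simp add: pderiv_sum pderiv_monom poly_sum poly_monom)
  also have "\<dots> = (\<Sum>k\<le>N. real k * (real k - 1) * coeff p k)"
  proof (rule sum.cong)
    fix k
    show "real (k - 1) * (real k * coeff p k) = real k * (real k - 1) * coeff p k"
      by (cases k) auto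
  qed simp
  finally show "poly (pderiv (pderiv p)) 1 = (\<Sum>k\<le>N. real k * (real k - 1) * coeff p k)" .
qed

text \<open>The numerator is the second moment about \<mu>, since G''(1) + G'(1) is the second
  moment about 0. For powers of a polynomial it follows by differentiation alone.\<close>

lemma poly_chebyshev:
  fixes G :: "real poly"
  assumes nonneg: "\<And>k. 0 \<le> coeff G k" and "poly G 1 = 1" and "\<mu> < real n"
  shows "1 - (poly (pderiv (pderiv G)) 1 + poly (pderiv G) 1 - 2 * \<mu> * poly (pderiv G) 1 + \<mu>\<^sup>2) / (real n - \<mu>)\<^sup>2
    \<le> (\<Sum>k\<le>n. coeff G k)"
proof -
  define N where "N = max n (degree G)"
  have N: "degree G \<le> N" "n \<le> N" by (auto simp: N_def)
  have "(real n - \<mu>)\<^sup>2 * (\<Sum>k\<in>{n<..N}. coeff G k) = (\<Sum>k\<in>{n<..N}. (real n - \<mu>)\<^sup>2 * coeff G k)"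
    by (simp add: sum_distrib_left)
  also have "\<dots> \<le> (\<Sum>k\<in>{n<..N}. (real k - \<mu>)\<^sup>2 * coeff G k)"
    using assms by (intro sum_mono mult_right_mono power_mono) auto
  also have "\<dots> \<le> (\<Sum>k\<le>N. (real k - \<mu>)\<^sup>2 * coeff G k)"
    using nonneg by (intro sum_mono2) auto
  also have "\<dots> = (\<Sum>k\<le>N. real k * (real k - 1) * coeff G k + real k * coeff G k
        - 2 * \<mu> * (real k * coeff G k) + \<mu>\<^sup>2 * coeff G k)"
    by (intro sum.cong) (auto simp: power2_eq_square algebra_simps)
  also have "\<dots> = poly (pderiv (pderiv G)) 1 + poly (pderiv G) 1 - 2 * \<mu> * poly (pderiv G) 1 + \<mu>\<^sup>2 * poly G 1"
    by (simp only: sum.distrib sum_subtractf sum_distrib_left poly_pderiv_1_eq_sum[OF N(1)] poly_1_eq_sum[OF N(1)])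
  finally have "(\<Sum>k\<in>{n<..N}. coeff G k)
      \<le> (poly (pderiv (pderiv G)) 1 + poly (pderiv G) 1 - 2 * \<mu> * poly (pderiv G) 1 + \<mu>\<^sup>2) / (real n - \<mu>)\<^sup>2"
    using assms by (simp add: field_simps)
  moreover have "(\<Sum>k\<le>n. coeff G k) + (\<Sum>k\<in>{n<..N}. coeff G k) = 1"
  proof -
    have "{..N} = {..n} \<union> {n<..N}" using N(2) by auto
    then have "(\<Sum>k\<le>N. coeff G k) = (\<Sum>k\<le>n. coeff G k) + (\<Sum>k\<in>{n<..N}. coeff G k)"
      by (simp only:) (intro sum.union_disjoint, auto)
    then show ?thesis using poly_1_eq_sum[OF N(1)] assms(2) by simp
  qed
  ultimately show ?thesis by linarith
qed

context renewal
begin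

text \<open>
  Moving the mass of \<open>f\<close> beyond \<open>n\<close> to \<open>0\<close> gives a polynomial \<open>H\<close> with \<open>H(1) = 1\<close>, whose powers
  obey Chebyshev's inequality.
\<close>

lemma lazy_power_tail_le:
  assumes n: "n \<ge> 1" and m: "real m * (\<Sum>j<n. z j) \<le> real n"
  shows "1 - l1_upto n (lazy ^ m)
    \<le> real m * z n / 2 + 2 * real m / (real n)\<^sup>2 * (\<Sum>j<n. real (2 * j + 1) * z j)"
proof -
  define T where "T = truncate_fps (Suc n) f"
  define H where "H = smult (1/2) ([:1 + z n:] + T)"
  define Q where "Q = (\<Sum>j<n. real (2 * j + 1) * z j)"
  define D where "D = poly (pderiv H) 1"
  have cT: "coeff T k = (if k \<le> n then fps_nth f k else 0)" for k
    by (auto simp: T_def coeff_truncate_fps)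
  have dT: "degree T \<le> n"
    using degree_truncate_fps[of "Suc n" f] by (simp add: T_def)
  have H_nonneg: "0 \<le> coeff H k" for k
    using f_nonneg z_nonneg[of n] by (auto simp: H_def cT coeff_pCons split: nat.splits)
  have T1: "poly T 1 = 1 - z n" by (simp add: poly_1_eq_sum[OF dT] cT z_eq)
  then have H1: "poly H 1 = 1" by (simp add: H_def)
  have dH: "pderiv H = smult (1/2) (pderiv T)"
    by (simp add: H_def pderiv_smult pderiv_add pderiv_pCons)
  have T': "poly (pderiv T) 1 = (\<Sum>k\<le>n. real k * fps_nth f k)"
    unfolding poly_pderiv_1_eq_sum[OF dT] by (intro sum.cong) (auto simp: cT)
  have T'': "poly (pderiv (pderiv T)) 1 = (\<Sum>k\<le>n. real k * (real k - 1) * fps_nth f k)"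
    unfolding poly_pderiv_1_eq_sum[OF dT] by (intro sum.cong) (auto simp: cT)
  have D: "D = (\<Sum>k\<le>n. real k * fps_nth f k) / 2"
    by (simp add: D_def dH T')
  have D0: "D \<ge> 0" unfolding D using f_nonneg by (auto intro!: sum_nonneg)
  have "0 \<le> real n * z n" "0 \<le> (real n)\<^sup>2 * z n" using z_nonneg by auto
  then have DL: "D \<le> (\<Sum>j<n. z j) / 2" and Q: "(\<Sum>k\<le>n. (real k)\<^sup>2 * fps_nth f k) \<le> Q"
    using first_moment[of n] second_moment[of n] unfolding D Q_def by linarith+
  have "poly (pderiv (pderiv H)) 1 + D
      = ((\<Sum>k\<le>n. real k * (real k - 1) * fps_nth f k) + (\<Sum>k\<le>n. real k * fps_nth f k)) / 2"
    by (simp add: D dH pderiv_smult T'' add_divide_distrib)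
  also have "\<dots> = (\<Sum>k\<le>n. (real k)\<^sup>2 * fps_nth f k) / 2"
    unfolding sum.distrib[symmetric] by (simp add: power2_eq_square algebra_simps)
  finally have HQ: "poly (pderiv (pderiv H)) 1 + D \<le> Q / 2" using Q by simp
  define G where "G = H ^ m"
  have fG: "fps_of_poly G = fps_of_poly H ^ m" by (simp add: G_def fps_of_poly_power)
  have G_nonneg: "0 \<le> coeff G k" for k
    using fps_power_nth_nonneg[of "fps_of_poly H" m k] H_nonneg fG by (metis fps_of_poly_nth)
  have G1: "poly G 1 = 1" by (simp add: G_def H1)
  have G': "poly (pderiv G) 1 = real m * D"
    by (simp add: G_def pderiv_power H1 D_def)
  have G'': "poly (pderiv (pderiv G)) 1 = real m * (real m - 1) * D\<^sup>2 + real m * poly (pderiv (pderiv H)) 1"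
  proof -
    have "poly (pderiv (pderiv G)) 1 = real m * real (m - 1) * D\<^sup>2 + real m * poly (pderiv (pderiv H)) 1"
      by (simp only: G_def pderiv_power pderiv_smult pderiv_mult poly_smult poly_add poly_mult poly_power
          H1 power_one D_def[symmetric] power2_eq_square) (simp add: algebra_simps)
    also have "real m * real (m - 1) = real m * (real m - 1)" by (cases m) auto
    finally show ?thesis .
  qed
  define \<mu> where "\<mu> = real m * D"
  \<comment> \<open>Laziness halves the mean of a step, so the hypothesis on \<open>m\<close> leaves
    a gap of n / 2 for Chebyshev's inequality.\<close>
  have "\<mu> \<le> real m * ((\<Sum>j<n. z j) / 2)" unfolding \<mu>_def by (intro mult_left_mono DL) auto
  then have \<mu>: "\<mu> \<le> real n / 2" using m by simp
  then have "\<mu> < real n" using n by simp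
  have "1 - (\<Sum>k\<le>n. coeff G k)
      \<le> (poly (pderiv (pderiv G)) 1 + poly (pderiv G) 1 - 2 * \<mu> * poly (pderiv G) 1 + \<mu>\<^sup>2) / (real n - \<mu>)\<^sup>2"
    using poly_chebyshev[OF G_nonneg G1 \<open>\<mu> < real n\<close>] by linarith
  \<comment> \<open>As \<mu> is the mean of \<open>G\<close>, the numerator is m times the variance
    of one truncated step.\<close>
  also have "\<dots> = (real m * (poly (pderiv (pderiv H)) 1 + D) - real m * D\<^sup>2) / (real n - \<mu>)\<^sup>2"
    by (simp add: G' G'' \<mu>_def power2_eq_square algebra_simps)
  also have "\<dots> \<le> (real m * (Q / 2)) / (real n - \<mu>)\<^sup>2"
  proof (intro divide_right_mono)
    have "real m * (poly (pderiv (pderiv H)) 1 + D) \<le> real m * (Q / 2)"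
      by (intro mult_left_mono HQ) auto
    moreover have "0 \<le> real m * D\<^sup>2" by simp
    ultimately show "real m * (poly (pderiv (pderiv H)) 1 + D) - real m * D\<^sup>2 \<le> real m * (Q / 2)" by linarith
  qed simp
  also have "\<dots> \<le> (real m * (Q / 2)) / (real n / 2)\<^sup>2"
  proof (intro divide_left_mono)
    show "(real n / 2)\<^sup>2 \<le> (real n - \<mu>)\<^sup>2" using \<mu> by (intro power_mono) auto
    show "0 \<le> real m * (Q / 2)" using z_nonneg by (auto simp: Q_def intro!: sum_nonneg mult_nonneg_nonneg)
  qed (use n \<open>\<mu> < real n\<close> in auto)
  also have "\<dots> = 2 * real m / (real n)\<^sup>2 * Q" by (simp add: power2_eq_square)
  finally have tail: "1 - (\<Sum>k\<le>n. coeff G k) \<le> 2 * real m / (real n)\<^sup>2 * Q" .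
  have l1H: "l1_upto n (fps_of_poly H) \<le> 1"
  proof -
    have "l1_upto n (fps_of_poly H) = (\<Sum>k\<le>n. coeff H k)"
      using H_nonneg by (simp add: l1_upto_def)
    also have "\<dots> = poly H 1"
      using dT by (intro poly_1_eq_sum[symmetric]) (auto simp: H_def intro!: degree_add_le)
    finally show ?thesis using H1 by simp
  qed
  have "l1_upto n (fps_of_poly H - lazy) = (\<Sum>k\<le>n. if k = 0 then z n / 2 else 0)"
    unfolding l1_upto_def
  proof (intro sum.cong)
    fix k assume "k \<in> {..n}"
    then show "\<bar>fps_nth (fps_of_poly H - lazy) k\<bar> = (if k = 0 then z n / 2 else 0)"
      using z_nonneg[of n]
      by (cases k) (auto simp: H_def lazy_def cT f_0 coeff_pCons algebra_simps add_divide_distrib)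
  qed simp
  then have diff: "l1_upto n (fps_of_poly H - lazy) = z n / 2"
    by simp
  \<comment> \<open>Up to n, \<open>H\<close> and \<open>lazy\<close> differ only at 0, by z n / 2;
    telescoping makes this at most m z n / 2 for the powers.\<close>
  have "(\<Sum>k\<le>n. coeff G k) = l1_upto n (lazy ^ m + (fps_of_poly H ^ m - lazy ^ m))"
    using G_nonneg by (simp add: l1_upto_def flip: fG)
  also have "\<dots> \<le> l1_upto n (lazy ^ m) + l1_upto n (fps_of_poly H ^ m - lazy ^ m)"
    by (rule l1_upto_add)
  also have "l1_upto n (fps_of_poly H ^ m - lazy ^ m) \<le> real m * (z n / 2)"
    using l1_upto_power_diff[OF l1H, of lazy m] lazy_power_le_1[of n 1] diff by simp
  finally show ?thesis using tail unfolding Q_def by simp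
qed

end

section \<open>Renewal chains\<close>

lemma tail_eq:
  assumes "return_law p"
  shows "tail p n = 1 - (\<Sum>k\<le>n. if k = 0 then 0 else p k)"
proof -
  have s: "(p has_sum 1) {1..}" using assms by (simp add: return_law_def)
  have "(p has_sum (\<Sum>k=1..n. p k)) {1..n}" by (intro has_sum_finite) auto
  then have "(p has_sum (1 - (\<Sum>k=1..n. p k))) ({1..} - {1..n})"
    using s by (intro has_sum_Diff) auto
  also have "{1..} - {1..n} = {n<..}" by auto
  finally have "tail p n = 1 - (\<Sum>k=1..n. p k)" by (simp add: tail_def infsumI)
  also have "(\<Sum>k=1..n. p k) = (\<Sum>k\<le>n. if k = 0 then 0 else p k)"
    by (intro sum.mono_neutral_cong_left) auto
  finally show ?thesis .
qed

lemma tail_nonneg: "return_law p \<Longrightarrow> 0 \<le> tail p n"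
  unfolding tail_def return_law_def by (intro infsum_nonneg) auto

lemma renewal_return_law:
  assumes "return_law p"
  shows "renewal (Abs_fps (\<lambda>k. if k = 0 then 0 else p k)) (tail p)"
  using assms tail_eq[OF assms] tail_nonneg[OF assms]
  by unfold_locales (auto simp: return_law_def)

lemma pmf_chain_kernel:
  assumes "0 \<le> q i" "q i \<le> 1"
  shows "pmf (chain_kernel q i) j = (if j = 0 then q i else if j = i + 1 then 1 - q i else 0)"
  using assms by (auto simp: chain_kernel_def map_pmf_def pmf_bind pmf_return indicator_def)

lemma pmf_transition_op:
  assumes "\<And>i. 0 \<le> q i \<and> q i \<le> 1" and "set_pmf \<mu> \<subseteq> {..n}"
  shows "pmf (transition_op q \<mu>) j
    = (\<Sum>i\<le>n. pmf \<mu> i * (if j = 0 then q i else if j = i + 1 then 1 - q i else 0))"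
  unfolding transition_op_def pmf_bind
  using assms by (subst integral_measure_pmf_real[of "{..n}"]) (auto simp: pmf_chain_kernel mult.commute)

context renewal
begin

lemma U_Suc: "fps_nth U (Suc n) = (\<Sum>i\<le>n. fps_nth U (n - i) * fps_nth f (Suc i))"
proof -
  have "U = 1 + f * U" using U_eq by (simp add: algebra_simps)
  then have "fps_nth U (Suc n) = fps_nth 1 (Suc n) + fps_nth (f * U) (Suc n)" by (metis fps_add_nth)
  also have "\<dots> = (\<Sum>i\<le>Suc n. fps_nth f i * fps_nth U (Suc n - i))"
    by (simp add: fps_mult_nth atMost_atLeast0)
  also have "\<dots> = (\<Sum>i\<le>n. fps_nth f (Suc i) * fps_nth U (n - i))"
    by (subst sum.atMost_Suc_shift) (simp add: f_0)
  finally show ?thesis by (simp add: mult.commute)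
qed

lemma U_0: "fps_nth U 0 = 1"
  unfolding U_def by (simp add: f_0)

text \<open>State j at time n means a renewal at time n - j followed by j steps without one.\<close>

lemma pmf_chain:
  assumes q: "\<And>i. 0 \<le> q i \<and> q i \<le> 1 \<and> (z i > 0 \<longrightarrow> q i = fps_nth f (Suc i) / z i)"
  shows "pmf ((transition_op q ^^ n) (return_pmf 0)) j = (if j \<le> n then fps_nth U (n - j) * z j else 0)"
proof (induction n arbitrary: j)
  case 0
  show ?case by (auto simp: U_0 z_eq f_0)
next
  case (Suc n)
  define \<mu> where "\<mu> = (transition_op q ^^ n) (return_pmf 0)"
  have \<mu>: "pmf \<mu> j = (if j \<le> n then fps_nth U (n - j) * z j else 0)" for j
    unfolding \<mu>_def by (rule Suc.IH)
  have supp: "set_pmf \<mu> \<subseteq> {..n}"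
    using \<mu> by (auto simp: set_pmf_iff split: if_splits)
  have zS: "z (Suc i) = z i - fps_nth f (Suc i)" for i by (simp add: z_eq)
  \<comment> \<open>Where z i = 0 the value q i is arbitrary, but then z (i + 1) \<ge> 0 forces the
    coefficient of f at i + 1 to vanish.\<close>
  have zq: "z i * q i = fps_nth f (Suc i)" for i
    using q[of i] z_nonneg[of i] z_nonneg[of "Suc i"] f_nonneg[of "Suc i"] zS[of i]
    by (cases "z i = 0") auto
  have "pmf (transition_op q \<mu>) j
      = (\<Sum>i\<le>n. fps_nth U (n - i) * z i * (if j = 0 then q i else if j = i + 1 then 1 - q i else 0))"
    using q supp by (subst pmf_transition_op[of q \<mu> n]) (auto simp: \<mu>)
  also have "\<dots> = (if j \<le> Suc n then fps_nth U (Suc n - j) * z j else 0)"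
  proof (cases j)
    case 0
    have "(\<Sum>i\<le>n. fps_nth U (n - i) * z i * q i) = (\<Sum>i\<le>n. fps_nth U (n - i) * fps_nth f (Suc i))"
      by (simp add: mult.assoc zq)
    then show ?thesis using 0 by (simp add: U_Suc z_eq f_0)
  next
    case (Suc i)
    have "(\<Sum>k\<le>n. fps_nth U (n - k) * z k * (if j = 0 then q k else if j = k + 1 then 1 - q k else 0))
        = (\<Sum>k\<le>n. if k = i then fps_nth U (n - k) * (z k * (1 - q k)) else 0)"
      using Suc by (intro sum.cong) auto
    also have "\<dots> = (if i \<le> n then fps_nth U (n - i) * (z i * (1 - q i)) else 0)"
      by (simp add: sum.delta)
    also have "z i * (1 - q i) = z (Suc i)" by (simp add: zS zq right_diff_distrib)
    finally show ?thesis using Suc by simp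
  qed
  finally show ?case by (simp add: \<mu>_def)
qed

end

section \<open>Total variation distance of two laws of the chain\<close>

lemma tv_norm_diff_le_2: "tv_norm_diff \<mu> \<nu> \<le> 2"
proof -
  have "(SUP A. \<bar>measure_pmf.prob \<mu> A - measure_pmf.prob \<nu> A\<bar>) \<le> 1"
  proof (rule cSUP_least)
    fix A
    show "\<bar>measure_pmf.prob \<mu> A - measure_pmf.prob \<nu> A\<bar> \<le> 1"
      using measure_pmf.prob_le_1[of \<mu> A] measure_pmf.prob_le_1[of \<nu> A]
        measure_nonneg[of "measure_pmf \<mu>" A] measure_nonneg[of "measure_pmf \<nu>" A] by linarith
  qed simp
  then show ?thesis by (simp add: tv_norm_diff_def)
qed

text \<open>The triangle inequality on each event alone loses a factor 2 against the l^1 norm, which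
  only enlarges the final constant.\<close>

lemma tv_norm_diff_le_sum:
  assumes "finite S" "set_pmf \<mu> \<subseteq> S" "set_pmf \<nu> \<subseteq> S"
  shows "tv_norm_diff \<mu> \<nu> \<le> 2 * (\<Sum>j\<in>S. \<bar>pmf \<mu> j - pmf \<nu> j\<bar>)"
proof -
  have prob: "measure_pmf.prob M A = (\<Sum>j\<in>A \<inter> S. pmf M j)" if "set_pmf M \<subseteq> S" for M A
  proof -
    have "measure_pmf.prob M A = measure_pmf.prob M (A \<inter> S)"
      using that by (intro measure_prob_cong_0) (auto simp: pmf_eq_0_set_pmf)
    then show ?thesis using assms by (simp add: measure_measure_pmf_finite)
  qed
  have "(SUP A. \<bar>measure_pmf.prob \<mu> A - measure_pmf.prob \<nu> A\<bar>) \<le> (\<Sum>j\<in>S. \<bar>pmf \<mu> j - pmf \<nu> j\<bar>)"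
  proof (rule cSUP_least)
    fix A
    have "\<bar>measure_pmf.prob \<mu> A - measure_pmf.prob \<nu> A\<bar> \<le> (\<Sum>j\<in>A \<inter> S. \<bar>pmf \<mu> j - pmf \<nu> j\<bar>)"
      using assms by (simp add: prob sum_abs flip: sum_subtractf)
    also have "\<dots> \<le> (\<Sum>j\<in>S. \<bar>pmf \<mu> j - pmf \<nu> j\<bar>)"
      using assms by (intro sum_mono2) auto
    finally show "\<bar>measure_pmf.prob \<mu> A - measure_pmf.prob \<nu> A\<bar> \<le> (\<Sum>j\<in>S. \<bar>pmf \<mu> j - pmf \<nu> j\<bar>)" .
  qed simp
  then show ?thesis by (simp add: tv_norm_diff_def)
qed

lemma (in renewal) tv_norm_diff_chain_le:
  assumes q: "\<And>i. 0 \<le> q i \<and> q i \<le> 1 \<and> (z i > 0 \<longrightarrow> q i = fps_nth f (Suc i) / z i)"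
  shows "tv_norm_diff ((transition_op q ^^ (n + l)) (return_pmf 0)) ((transition_op q ^^ n) (return_pmf 0))
    \<le> 2 * wsum z (n + l) ((1 - fps_X ^ l) * U)"
proof -
  let ?\<mu> = "\<lambda>n. (transition_op q ^^ n) (return_pmf 0)"
  note pmf = pmf_chain[OF q]
  have "tv_norm_diff (?\<mu> (n + l)) (?\<mu> n) \<le> 2 * (\<Sum>j\<le>n + l. \<bar>pmf (?\<mu> (n + l)) j - pmf (?\<mu> n) j\<bar>)"
    by (intro tv_norm_diff_le_sum) (auto simp: set_pmf_iff pmf split: if_splits)
  also have "(\<Sum>j\<le>n + l. \<bar>pmf (?\<mu> (n + l)) j - pmf (?\<mu> n) j\<bar>)
      = (\<Sum>j\<le>n + l. \<bar>fps_nth ((1 - fps_X ^ l) * U) (n + l - j)\<bar> * z j)"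
  proof (intro sum.cong refl)
    fix j assume "j \<in> {..n + l}"
    \<comment> \<open>For j > n both the mass at time n and the coefficient of X^l U vanish.\<close>
    then have "pmf (?\<mu> (n + l)) j - pmf (?\<mu> n) j = fps_nth ((1 - fps_X ^ l) * U) (n + l - j) * z j"
      by (auto simp: pmf left_diff_distrib fps_X_power_mult_nth)
    then show "\<bar>pmf (?\<mu> (n + l)) j - pmf (?\<mu> n) j\<bar> = \<bar>fps_nth ((1 - fps_X ^ l) * U) (n + l - j)\<bar> * z j"
      using z_nonneg[of j] by (simp add: abs_mult)
  qed
  also have "\<dots> = wsum z (n + l) ((1 - fps_X ^ l) * U)"
    unfolding wsum_def
    by (rule sum.reindex_bij_witness[where i = "\<lambda>k. n + l - k" and j = "\<lambda>k. n + l - k"]) auto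
  finally show ?thesis .
qed

text \<open>
  With \<open>(l / \<rho>(n))\<^sup>2\<^sup>/\<^sup>3\<close> steps the tail of the sum of the steps and the smoothing error are of the
  same order; \<open>admissible\<close> says that the expected sum of the truncated steps stays below \<open>n\<close>.
\<close>

lemma admissible_steps:
  fixes \<rho> :: "real \<Rightarrow> real"
  assumes rv: "regularly_varying 1 (- \<alpha>) \<rho>" and "\<alpha> < 3/2"
  shows "\<exists>K\<ge>1. \<forall>z n l. (\<forall>j. 0 \<le> z j \<and> z j \<le> 1) \<and> (\<forall>j\<ge>1. z j \<le> \<rho> (real j)) \<and> n \<ge> 1 \<and>
      admissible \<alpha> \<rho> n l \<and> real l powr (2/3) * \<rho> (real n) powr (1/3) \<le> 1 \<longrightarrow>
      (real l / \<rho> (real n)) powr (2/3) * (\<Sum>j<n. z j) \<le> K * real n"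
proof -
  have pos: "\<rho> x > 0" if "x \<ge> 1" for x
    using rv that by (auto simp: regularly_varying_def)
  consider "\<alpha> < 1" | "\<alpha> = 1" | "\<alpha> > 1" by linarith
  then show ?thesis
  proof cases
    case 1
    \<comment> \<open>The sum is O(n \<rho>(n)). Multiplied by (l / \<rho>(n))^(2/3) it becomes n
      times the quantity assumed to be at most 1.\<close>
    then have "\<alpha> < 0 + 1" by simp
    from karamata_tail_sum[OF rv this order_refl] obtain K where
      K: "\<And>z n. (\<forall>j. z j \<le> 1) \<Longrightarrow> (\<forall>j\<ge>1. z j \<le> \<rho> (real j)) \<Longrightarrow> n \<ge> 1 \<Longrightarrow>
        (\<Sum>j<n. real (j + 1) powr 0 * z j) \<le> K * real n powr (0 + 1) * \<rho> (real n)"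
      by blast
    show ?thesis
    proof (intro exI[of _ "max 1 K"] conjI allI impI)
      fix z n l
      assume *: "(\<forall>j. 0 \<le> z j \<and> z j \<le> 1) \<and> (\<forall>j\<ge>1. z j \<le> \<rho> (real j)) \<and> n \<ge> 1 \<and>
        admissible \<alpha> \<rho> n l \<and> real l powr (2/3) * \<rho> (real n) powr (1/3) \<le> 1"
      then have "\<rho> (real n) > 0" by (intro pos) auto
      have "(\<Sum>j<n. z j) \<le> K * real n * \<rho> (real n)" using K[of z n] * by simp
      then have "(real l / \<rho> (real n)) powr (2/3) * (\<Sum>j<n. z j)
          \<le> (real l / \<rho> (real n)) powr (2/3) * (K * real n * \<rho> (real n))"
        by (intro mult_left_mono) auto
      also have "\<dots> = K * real n * (real l powr (2/3) * \<rho> (real n) powr (1/3))"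
      proof -
        have "\<rho> (real n) = \<rho> (real n) powr (2/3) * \<rho> (real n) powr (1/3)"
          using \<open>\<rho> (real n) > 0\<close> by (simp flip: powr_add)
        then show ?thesis using \<open>\<rho> (real n) > 0\<close> by (simp add: powr_divide field_simps)
      qed
      also have "\<dots> \<le> max 1 K * real n * 1"
        using * by (intro mult_mono) auto
      finally show "(real l / \<rho> (real n)) powr (2/3) * (\<Sum>j<n. z j) \<le> max 1 K * real n" by simp
    qed simp
  next
    case 2
    obtain K where K: "\<And>z n. (\<forall>j. z j \<le> 1) \<Longrightarrow> (\<forall>j\<ge>1. z j \<le> \<rho> (real j)) \<Longrightarrow> trunc_mean \<rho> n < \<infinity> \<Longrightarrow>
        (\<Sum>j<n. z j) \<le> K * enn2real (trunc_mean \<rho> n)"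
      using tail_sum_le_trunc_mean[OF rv] by blast
    show ?thesis
    proof (intro exI[of _ "max 1 K"] conjI allI impI)
      fix z n l
      assume *: "(\<forall>j. 0 \<le> z j \<and> z j \<le> 1) \<and> (\<forall>j\<ge>1. z j \<le> \<rho> (real j)) \<and> n \<ge> 1 \<and>
        admissible \<alpha> \<rho> n l \<and> real l powr (2/3) * \<rho> (real n) powr (1/3) \<le> 1"
      then have "\<rho> (real n) > 0" by (intro pos) auto
      define M where "M = enn2real (trunc_mean \<rho> n)"
      have fin: "trunc_mean \<rho> n < \<infinity>" and l: "real l \<le> \<rho> (real n) * real n powr (3/2) * M powr (-3/2)"
        using * 2 by (auto simp: admissible_def M_def)
      have "trunc_mean \<rho> n \<noteq> 0" by (simp add: trunc_mean_def)
      then have "M > 0" using fin by (simp add: M_def enn2real_positive_iff zero_less_iff_neq_zero)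
      \<comment> \<open>Raised to the power 2/3 the restriction reads (l / \<rho>(n))^(2/3) \<le> n
        / M(n), and M(n) cancels against the bound for the sum.\<close>
      have "real l / \<rho> (real n) \<le> real n powr (3/2) * M powr (-3/2)"
        using l \<open>\<rho> (real n) > 0\<close> by (simp add: field_simps)
      then have "(real l / \<rho> (real n)) powr (2/3) \<le> (real n powr (3/2) * M powr (-3/2)) powr (2/3)"
        using \<open>\<rho> (real n) > 0\<close> by (intro powr_mono2) auto
      also have "\<dots> = real n / M"
        using * \<open>M > 0\<close> by (simp add: powr_mult powr_divide powr_powr powr_minus_divide)
      finally have "(real l / \<rho> (real n)) powr (2/3) * (\<Sum>j<n. z j) \<le> (real n / M) * (K * M)"
        using K[of z n] * fin \<open>M > 0\<close> by (intro mult_mono) (auto simp: M_def intro!: sum_nonneg)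
      also have "\<dots> = K * real n" using \<open>M > 0\<close> by simp
      also have "\<dots> \<le> max 1 K * real n" by (intro mult_right_mono) auto
      finally show "(real l / \<rho> (real n)) powr (2/3) * (\<Sum>j<n. z j) \<le> max 1 K * real n" .
    qed simp
  next
    case 3
    \<comment> \<open>The sum is bounded, and the restriction raised to the power 2/3 bounds the
      other factor by n.\<close>
    then obtain K where K: "\<And>z n. (\<forall>j. z j \<le> 1) \<Longrightarrow> (\<forall>j\<ge>1. z j \<le> \<rho> (real j)) \<Longrightarrow> (\<Sum>j<(n::nat). z j) \<le> K"
      using tail_sum_bounded[OF rv] by blast
    show ?thesis
    proof (intro exI[of _ "max 1 K"] conjI allI impI)
      fix z n l
      assume *: "(\<forall>j. 0 \<le> z j \<and> z j \<le> 1) \<and> (\<forall>j\<ge>1. z j \<le> \<rho> (real j)) \<and> n \<ge> 1 \<and>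
        admissible \<alpha> \<rho> n l \<and> real l powr (2/3) * \<rho> (real n) powr (1/3) \<le> 1"
      then have "\<rho> (real n) > 0" by (intro pos) auto
      have l: "real l \<le> \<rho> (real n) * real n powr (3/2)"
        using * 3 \<open>\<alpha> < 3/2\<close> by (auto simp: admissible_def)
      then have "(real l / \<rho> (real n)) powr (2/3) \<le> (real n powr (3/2)) powr (2/3)"
        using \<open>\<rho> (real n) > 0\<close> by (intro powr_mono2) (auto simp: field_simps)
      also have "\<dots> = real n" by (simp add: powr_powr)
      finally have "(real l / \<rho> (real n)) powr (2/3) * (\<Sum>j<n. z j) \<le> real n * max 1 K"
        using K[of z n] * by (intro mult_mono) (auto intro!: sum_nonneg)
      then show "(real l / \<rho> (real n)) powr (2/3) * (\<Sum>j<n. z j) \<le> max 1 K * real n"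
        by (simp add: mult.commute)
    qed simp
  qed
qed

section \<open>Balance of the tail error and the smoothing error\<close>

theorem theorem2p6:
  fixes \<alpha> c :: real and \<rho> :: "real \<Rightarrow> real" and N :: nat
  assumes "0 < \<alpha>" and "\<alpha> < 3/2"
    and "regularly_varying 1 (- \<alpha>) \<rho>"
    and "c > 0" and "N \<ge> 1"
  shows "\<exists>C::real. \<forall>(p :: nat \<Rightarrow> real) (q :: nat \<Rightarrow> real).
           return_law p \<and> reset_probs p q \<and>
           Gcd {k. 1 \<le> k \<and> k \<le> N \<and> p k \<ge> c} = 1 \<and>
           (\<forall>n\<ge>1. tail p n \<le> \<rho> (real n)) \<longrightarrow>
           (\<forall>n\<ge>1. \<forall>l\<ge>1. admissible \<alpha> \<rho> n l \<longrightarrow>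
              tv_norm_diff ((transition_op q ^^ (n + l)) (return_pmf 0))
                           ((transition_op q ^^ n) (return_pmf 0))
                \<le> C * real l powr (2/3) * \<rho> (real n) powr (1/3))"
proof -
  note rv = assms(3)
  have pos: "\<rho> x > 0" if "x \<ge> 1" for x
    using rv that by (auto simp: regularly_varying_def)
  obtain S where "S \<ge> 0" and S: "\<And>f m l n. (\<forall>k. fps_nth f k \<ge> 0) \<Longrightarrow> (\<forall>n. l1_upto n f \<le> 1) \<Longrightarrow>
      Gcd {k. 1 \<le> k \<and> k \<le> N \<and> fps_nth f k \<ge> c} = 1 \<Longrightarrow>
      l1_upto n ((1 - fps_X ^ l) * (fps_const (1/2) * (1 + f)) ^ m) \<le> S * real l / sqrt (real (m + 1))"
    using lazy_power_smoothing[OF \<open>c > 0\<close>, of N] by blast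
  obtain K where "K \<ge> 1" and K: "\<And>z n l. (\<forall>j. 0 \<le> z j \<and> z j \<le> 1) \<Longrightarrow> (\<forall>j\<ge>1. z j \<le> \<rho> (real j)) \<Longrightarrow> n \<ge> 1 \<Longrightarrow>
      admissible \<alpha> \<rho> n l \<Longrightarrow> real l powr (2/3) * \<rho> (real n) powr (1/3) \<le> 1 \<Longrightarrow>
      (real l / \<rho> (real n)) powr (2/3) * (\<Sum>j<n. z j) \<le> K * real n"
    using admissible_steps[OF rv \<open>\<alpha> < 3/2\<close>] by blast
  then have "K > 0" by simp
  have "\<alpha> < 1 + 1" using \<open>\<alpha> < 3/2\<close> by simp
  from karamata_tail_sum[OF rv this zero_le_one] obtain B where
    B: "\<And>z n. (\<forall>j. z j \<le> 1) \<Longrightarrow> (\<forall>j\<ge>1. z j \<le> \<rho> (real j)) \<Longrightarrow> n \<ge> 1 \<Longrightarrow>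
      (\<Sum>j<n. real (j + 1) powr 1 * z j) \<le> B * real n powr (1 + 1) * \<rho> (real n)"
    by blast
  \<comment> \<open>The 2 covers the trivial bound as well as the truncation error. In 16 = 2 * 2 *
    4 meet the crude total variation bound, the two copies of the tail and the Chebyshev term. The
    sign of \<open>B\<close> is unknown, hence the maximum.\<close>
  define C where "C = 2 + 16 * max 0 B + 2 * S * sqrt K"
  have "C \<ge> 2" using \<open>S \<ge> 0\<close> \<open>K > 0\<close> by (simp add: C_def)
  show ?thesis
  proof (intro exI[of _ C] allI impI)
    fix p q n l
    assume pq: "return_law p \<and> reset_probs p q \<and> Gcd {k. 1 \<le> k \<and> k \<le> N \<and> p k \<ge> c} = 1 \<and>
      (\<forall>n\<ge>1. tail p n \<le> \<rho> (real n))" and n: "1 \<le> n" and l: "1 \<le> l" and adm: "admissible \<alpha> \<rho> n l"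
    define f where "f = Abs_fps (\<lambda>k. if k = 0 then 0 else p k)"
    define z where "z = tail p"
    define r where "r = \<rho> (real n)"
    define D where "D = real l powr (2/3) * r powr (1/3)"
    define t where "t = (real l / r) powr (2/3)"
    \<comment> \<open>Dividing by \<open>K\<close> keeps m times the truncated mean below n.
      Rounding down is harmless, even to 0, because the smoothing bound contains m + 1.\<close>
    define m where "m = nat \<lfloor>t / K\<rfloor>"
    let ?TV = "tv_norm_diff ((transition_op q ^^ (n + l)) (return_pmf 0)) ((transition_op q ^^ n) (return_pmf 0))"
    have "r > 0" unfolding r_def using n by (intro pos) auto
    have "D > 0" "t > 0" using \<open>r > 0\<close> l by (auto simp: D_def t_def)
    \<comment> \<open>At the balance point t the tail error t r and the smoothing error l / sqrt t
      both equal \<open>D\<close>.\<close>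
    have tr: "t * r = D"
    proof -
      have "r = r powr (2/3) * r powr (1/3)" using \<open>r > 0\<close> by (simp flip: powr_add)
      then show ?thesis using \<open>r > 0\<close> by (simp add: D_def t_def powr_divide field_simps)
    qed
    have lt: "real l / sqrt t = D"
    proof -
      have "sqrt t = real l powr (1/3) / r powr (1/3)"
        using \<open>r > 0\<close> by (simp add: t_def powr_half_sqrt[symmetric] powr_powr powr_divide)
      then have "D * sqrt t = real l powr (2/3) * real l powr (1/3)"
        using \<open>r > 0\<close> by (simp add: D_def)
      also have "\<dots> = real l" using l by (simp flip: powr_add)
      finally show ?thesis using \<open>t > 0\<close> by (simp add: field_simps)
    qed
    have "?TV \<le> C * D"
    proof (cases "D \<le> 1")
      case False
      have "?TV \<le> 2" by (rule tv_norm_diff_le_2)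
      also have "\<dots> \<le> C * D" using False \<open>C \<ge> 2\<close> mult_mono[of 2 C 1 D] by simp
      finally show ?thesis .
    next
      case True
      interpret renewal f z
        unfolding f_def z_def using pq by (intro renewal_return_law) auto
      have z: "\<forall>j. 0 \<le> z j \<and> z j \<le> 1" "\<forall>j\<ge>1. z j \<le> \<rho> (real j)"
        using z_nonneg z_eq pq f_nonneg by (auto simp: z_def intro!: sum_nonneg)
      have q: "0 \<le> q i \<and> q i \<le> 1 \<and> (z i > 0 \<longrightarrow> q i = fps_nth f (Suc i) / z i)" for i
        using pq by (auto simp: reset_probs_def z_def f_def)
      have m: "real m \<le> t / K" "t / K \<le> real (m + 1)"
        using \<open>t > 0\<close> \<open>K > 0\<close> by (auto simp: m_def) linarith+
      have "real m * 1 \<le> real m * K" using \<open>K \<ge> 1\<close> by (intro mult_left_mono) auto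
      also have "\<dots> \<le> t" using m(1) \<open>K > 0\<close> by (simp add: field_simps)
      finally have mt: "real m \<le> t" by simp
      define Q where "Q = (\<Sum>j<n. real (2 * j + 1) * z j)"
      have tK: "t * (\<Sum>j<n. z j) \<le> K * real n"
        unfolding t_def r_def using K z n adm True by (auto simp: D_def r_def)
      have "real m * (\<Sum>j<n. z j) \<le> t / K * (\<Sum>j<n. z j)"
        using m z by (intro mult_right_mono) (auto intro!: sum_nonneg)
      also have "\<dots> \<le> real n" using tK \<open>K > 0\<close> by (simp add: field_simps)
      finally have "1 - l1_upto n (lazy ^ m) \<le> real m * z n / 2 + 2 * real m / (real n)\<^sup>2 * Q"
        unfolding Q_def using n by (intro lazy_power_tail_le)
      also have "\<dots> \<le> t * r / 2 + 2 * t / (real n)\<^sup>2 * (2 * max 0 B * (real n)\<^sup>2 * r)"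
      proof (intro add_mono mult_mono divide_right_mono)
        show "z n \<le> r" using z n by (simp add: r_def)
        \<comment> \<open>The weights 2 j + 1 are at most 2 (j + 1), the form to which Karamata's
          estimate with \<kappa> = 1 applies.\<close>
        have "Q \<le> (\<Sum>j<n. 2 * (real (j + 1) powr 1 * z j))"
          unfolding Q_def using z by (intro sum_mono) (simp add: mult_right_mono flip: mult.assoc)
        also have "\<dots> \<le> 2 * (B * real n powr (1 + 1) * r)"
          unfolding sum_distrib_left[symmetric] r_def using B z n by (intro mult_left_mono) auto
        also have "real n powr (1 + 1) = (real n)\<^sup>2" using n by (simp add: powr_numeral)
        also have "2 * (B * (real n)\<^sup>2 * r) \<le> 2 * max 0 B * (real n)\<^sup>2 * r"
          using \<open>r > 0\<close> by (simp add: mult_right_mono)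
        finally show "Q \<le> 2 * max 0 B * (real n)\<^sup>2 * r" .
        show "0 \<le> Q" unfolding Q_def using z by (auto intro!: sum_nonneg mult_nonneg_nonneg)
      qed (use z mt \<open>t > 0\<close> in auto)
      also have "\<dots> = t * r / 2 + 4 * max 0 B * (t * r)"
        using n by (simp add: field_simps)
      finally have tail: "1 - l1_upto n (lazy ^ m) \<le> D / 2 + 4 * max 0 B * D"
        unfolding tr .
      have "l1_upto (n + l) ((1 - fps_X ^ l) * lazy ^ m) \<le> S * real l / sqrt (real (m + 1))"
        unfolding lazy_def
      proof (rule S)
        have "{k. 1 \<le> k \<and> k \<le> N \<and> fps_nth f k \<ge> c} = {k. 1 \<le> k \<and> k \<le> N \<and> p k \<ge> c}"
          by (auto simp: f_def)
        then show "Gcd {k. 1 \<le> k \<and> k \<le> N \<and> fps_nth f k \<ge> c} = 1" using pq by simp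
      qed (use f_nonneg f_le_1 in auto)
      also have "\<dots> \<le> S * real l / sqrt (t / K)"
        using m(2) \<open>t > 0\<close> \<open>K > 0\<close> \<open>S \<ge> 0\<close> by (intro divide_left_mono) auto
      also have "\<dots> = S * sqrt K * D"
        using \<open>t > 0\<close> \<open>K > 0\<close> by (simp add: lt[symmetric] real_sqrt_divide)
      finally have smooth: "l1_upto (n + l) ((1 - fps_X ^ l) * lazy ^ m) \<le> S * sqrt K * D" .
      have "?TV \<le> 2 * (2 * (1 - l1_upto n (lazy ^ m)) + l1_upto (n + l) ((1 - fps_X ^ l) * lazy ^ m))"
        by (rule order_trans[OF tv_norm_diff_chain_le[OF q] mult_left_mono[OF wsum_shift_diff_U_le]]) simp
      also have "\<dots> \<le> 2 * (2 * (D / 2 + 4 * max 0 B * D) + S * sqrt K * D)"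
        by (intro mult_left_mono add_mono tail smooth) auto
      also have "\<dots> = C * D" by (simp add: C_def algebra_simps)
      finally show ?thesis .
    qed
    then show "?TV \<le> C * real l powr (2/3) * \<rho> (real n) powr (1/3)"
      by (simp add: D_def r_def mult.assoc)
  qed
qed

end
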